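(* Let $G$ be a finitely generated, virtually abelian group, and let $X$ and $Y$ be finite generating sets for $G$. Then $\mathrm{cr}_X(G)=\mathrm{cr}_Y(G)$.
   Context: For a group $G$ with finite generating set $X$, $\mathbb{B}_{G,X}(n)$ is the ball of radius $n$ about the identity for the word length over $X\cup X^{-1}$, and $C_{G,X}(n)$ is the set of conjugacy classes of $G$ having a representative in $\mathbb{B}_{G,X}(n)$. The conjugacy ratio is $\mathrm{cr}_X(G)=\limsup_{n\to\infty}\frac{|C_{G,X}(n)|}{|\mathbb{B}_{G,X}(n)|}$. *)

theory Defs
  imports "HOL-Algebra.Generated_Groups" "HOL-Algebra.Group_Action" "HOL-Library.Extended_Real" "HOL-Library.Liminf_Limsup"
begin

definition finite_generating_set :: "('a, 'b) monoid_scheme \<Rightarrow> 'a set \<Rightarrow> bool" where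
  "finite_generating_set G S \<longleftrightarrow> finite S \<and> S \<subseteq> carrier G \<and> generate G S = carrier G"

definition finitely_generated :: "('a, 'b) monoid_scheme \<Rightarrow> bool" where
  "finitely_generated G \<longleftrightarrow> (\<exists>S. finite_generating_set G S)"

definition virtually_abelian :: "('a, 'b) monoid_scheme \<Rightarrow> bool" where
  "virtually_abelian G \<longleftrightarrow>
    (\<exists>H. subgroup H G \<and> comm_group (G\<lparr>carrier := H\<rparr>) \<and> finite (rcosets\<^bsub>G\<^esub> H))"

definition words_over :: "('a, 'b) monoid_scheme \<Rightarrow> 'a set \<Rightarrow> 'a list set" where
  "words_over G S = lists (S \<union> m_inv G ` S)"

definition word_eval :: "('a, 'b) monoid_scheme \<Rightarrow> 'a list \<Rightarrow> 'a" where
  "word_eval G ws = foldr (\<otimes>\<^bsub>G\<^esub>) ws \<one>\<^bsub>G\<^esub>"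

text \<open>The length is extended-valued so that it is infinite (the infimum of the empty set)
  on elements outside the subgroup generated by \<open>S\<close>.\<close>

definition word_length :: "('a, 'b) monoid_scheme \<Rightarrow> 'a set \<Rightarrow> 'a \<Rightarrow> enat" where
  "word_length G S g = (INF ws\<in>{ws \<in> words_over G S. word_eval G ws = g}. enat (length ws))"

definition word_ball :: "('a, 'b) monoid_scheme \<Rightarrow> 'a set \<Rightarrow> nat \<Rightarrow> 'a set" where
  "word_ball G S n = {g \<in> carrier G. word_length G S g \<le> enat n}"

definition conjugacy_classes :: "('a, 'b) monoid_scheme \<Rightarrow> 'a set set" where
  "conjugacy_classes G =
    orbits G (carrier G) (\<lambda>g. \<lambda>h\<in>carrier G. g \<otimes>\<^bsub>G\<^esub> h \<otimes>\<^bsub>G\<^esub> inv\<^bsub>G\<^esub> g)"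

definition ball_conjugacy_classes ::
    "('a, 'b) monoid_scheme \<Rightarrow> 'a set \<Rightarrow> nat \<Rightarrow> 'a set set" where
  "ball_conjugacy_classes G S n = {c \<in> conjugacy_classes G. c \<inter> word_ball G S n \<noteq> {}}"

text \<open>Taken in \<^typ>\<open>ereal\<close> because there \<open>limsup\<close> is unconditionally meaningful;
  for finite \<open>S\<close> every quotient lies in the unit interval.\<close>

definition conjugacy_ratio :: "('a, 'b) monoid_scheme \<Rightarrow> 'a set \<Rightarrow> ereal" where
  "conjugacy_ratio G S =
    limsup (\<lambda>n. ereal (real (card (ball_conjugacy_classes G S n)) / real (card (word_ball G S n))))"

end

theory Submission
  imports Defs
begin

text \<open>
  An explicit limit for the ratio is found that does not mention the generating set. Let \<open>b n\<close> be
  the size of the ball of radius \<open>n\<close>.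

  Writing group elements with Schreier generators of the abelian subgroup \<open>A\<close> compares balls with
  boxes of exponents, so \<open>b\<close> is doubling: \<open>b (4 n) \<le> K b n\<close>. In a doubling Cayley graph, a shell of
  width \<open>k\<close> is at most \<open>K\<close> times as large as the shell of width \<open>4 k\<close> just inside it; iterating over
  the scales \<open>k = 5\<^sup>j\<close> gives \<open>b (n + 1) / b n \<longlonglongrightarrow> 1\<close>. Hence bounded perturbations of the radius are
  negligible, and a subgroup \<open>H\<close> has density \<open>1 / [G : H]\<close>, or \<open>0\<close> if the index is infinite.

  Elements with infinite conjugacy class have arbitrarily many conjugates under a finite set of
  conjugators chosen uniformly, so their classes do not contribute. The elements with finite class
  form a subgroup \<open>F\<close> that is centralized by a subgroup \<open>N\<close> of finite index. So the remaining classes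
  are counted, up to a bounded change of radius, by summing \<open>1 / card (cls x)\<close> over \<open>x \<in> F\<close> in the
  ball, and this summand is the proportion of cosets of \<open>N\<close> that commute with \<open>x\<close>. Exchanging the sums
  expresses the limit by densities of the subgroups \<open>{x \<in> F. x r = r x}\<close>.
\<close>

section \<open>Coset representatives\<close>

context group
begin

lemma inv_cancel_left:
  assumes "x \<in> carrier G" "y \<in> carrier G"
  shows "inv x \<otimes> (x \<otimes> y) = y" "x \<otimes> (inv x \<otimes> y) = y"
  using assms by (simp_all flip: m_assoc)

text \<open>The choice is made from the coset as a set, so it is constant on each coset. The
  representative of \<open>H\<close> itself need not be \<open>\<one>\<close>.\<close>

definition rrep :: "'a set \<Rightarrow> 'a \<Rightarrow> 'a" where
  "rrep H g = (SOME h. h \<in> H #> g)"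

text \<open>A right transversal: its cardinality is the index of \<open>H\<close> if that is finite,
  and \<open>card\<close> gives 0 otherwise.\<close>

definition rreps :: "'a set \<Rightarrow> 'a set" where
  "rreps H = rrep H ` carrier G"

lemma rrep_mem:
  assumes "subgroup H G" "g \<in> carrier G"
  shows "rrep H g \<in> H #> g"
  unfolding rrep_def using rcos_self[OF assms(2,1)] by (rule someI)

lemma rrep_closed:
  assumes "subgroup H G" "g \<in> carrier G"
  shows "rrep H g \<in> carrier G"
  using rrep_mem[OF assms] assms r_coset_subset_G subgroup.subset by blast

lemma rreps_closed: "subgroup H G \<Longrightarrow> rreps H \<subseteq> carrier G"
  by (auto simp: rreps_def rrep_closed)

lemma mem_rcos_iff:
  assumes "subgroup H G" "g \<in> carrier G" "h \<in> carrier G"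
  shows "h \<in> H #> g \<longleftrightarrow> h \<otimes> inv g \<in> H"
  using assms subgroup.rcos_module by (metis is_group)

lemma mult_inv_rrep:
  assumes "subgroup H G" "g \<in> carrier G"
  shows "g \<otimes> inv (rrep H g) \<in> H"
proof -
  have "rrep H g \<otimes> inv g \<in> H"
    using rrep_mem[OF assms] mem_rcos_iff assms rrep_closed by blast
  then have "inv (rrep H g \<otimes> inv g) \<in> H"
    by (rule subgroup.m_inv_closed[OF assms(1)])
  then show ?thesis
    using assms rrep_closed by (simp add: inv_mult_group)
qed

lemma rrep_eq_iff:
  assumes "subgroup H G" "g \<in> carrier G" "h \<in> carrier G"
  shows "rrep H g = rrep H h \<longleftrightarrow> g \<otimes> inv h \<in> H"
proof
  assume eq: "rrep H g = rrep H h"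
  have "(g \<otimes> inv (rrep H g)) \<otimes> inv (h \<otimes> inv (rrep H h)) \<in> H"
    using assms mult_inv_rrep subgroup.m_closed subgroup.m_inv_closed by metis
  moreover have "(g \<otimes> inv (rrep H g)) \<otimes> inv (h \<otimes> inv (rrep H h)) = g \<otimes> inv h"
    using assms rrep_closed unfolding eq by (simp add: inv_mult_group m_assoc inv_cancel_left)
  ultimately show "g \<otimes> inv h \<in> H" by simp
next
  assume "g \<otimes> inv h \<in> H"
  then have "g \<in> H #> h" using assms mem_rcos_iff by blast
  then have "H #> h = H #> g" using repr_independence assms by blast
  then show "rrep H g = rrep H h" by (simp add: rrep_def)
qed

lemma rrep_rrep:
  assumes "subgroup H G" "g \<in> carrier G"
  shows "rrep H (rrep H g) = rrep H g"
  using rrep_eq_iff[OF assms(1,2) rrep_closed[OF assms]] mult_inv_rrep[OF assms] by simp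

lemma rreps_rrep:
  assumes "subgroup H G" "r \<in> rreps H"
  shows "rrep H r = r"
  using assms rrep_rrep by (auto simp: rreps_def)

lemma finite_rreps:
  assumes "finite (rcosets H)"
  shows "finite (rreps H)"
proof -
  have "rreps H \<subseteq> (\<lambda>C. SOME h. h \<in> C) ` (rcosets H)"
    by (auto simp: rreps_def rrep_def RCOSETS_def)
  then show ?thesis using assms finite_surj by blast
qed

end

section \<open>Balls and shells\<close>

locale fin_gen_group = group G for G (structure) +
  fixes S :: "'a set"
  assumes fgs: "finite_generating_set G S"
begin

abbreviation ball :: "nat \<Rightarrow> 'a set" where
  "ball n \<equiv> word_ball G S n"

abbreviation growth :: "nat \<Rightarrow> nat" where
  "growth n \<equiv> card (ball n)"

lemma gens_closed: "S \<union> m_inv G ` S \<subseteq> carrier G"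
  using fgs by (auto simp: finite_generating_set_def)

lemma word_eval_closed: "ws \<in> words_over G S \<Longrightarrow> word_eval G ws \<in> carrier G"
  unfolding words_over_def word_eval_def
  by (induction ws rule: lists.induct) (use gens_closed in auto)

lemma word_eval_append:
  assumes "us \<in> words_over G S" "vs \<in> words_over G S"
  shows "word_eval G (us @ vs) = word_eval G us \<otimes> word_eval G vs"
  using assms(1) unfolding words_over_def
proof (induction us rule: lists.induct)
  case Nil
  then show ?case using word_eval_closed[OF assms(2)] by (simp add: word_eval_def)
next
  case (Cons u us)
  then show ?case
    using word_eval_closed[OF assms(2)] word_eval_closed[of us] gens_closed
    by (auto simp: word_eval_def words_over_def m_assoc)
qed

text \<open>A nonempty infimum in \<open>enat\<close> is attained, so a finite bound on
  \<open>word_length\<close> yields an actual word. The infimum over the empty set is infinite and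
  cannot satisfy the bound.\<close>

lemma ball_iff:
  "g \<in> ball n \<longleftrightarrow> (\<exists>ws \<in> words_over G S. length ws \<le> n \<and> word_eval G ws = g)"
proof
  assume "g \<in> ball n"
  define L where "L = (\<lambda>ws. enat (length ws)) ` {ws \<in> words_over G S. word_eval G ws = g}"
  have le: "Inf L \<le> enat n"
    using \<open>g \<in> ball n\<close> by (simp add: word_ball_def word_length_def L_def)
  then have "L \<noteq> {}" by (auto simp: top_enat_def)
  then have "Inf L \<in> L" by (metis Inf_enat_def LeastI ex_in_conv)
  with le show "\<exists>ws \<in> words_over G S. length ws \<le> n \<and> word_eval G ws = g"
    by (auto simp: L_def)
next
  assume "\<exists>ws \<in> words_over G S. length ws \<le> n \<and> word_eval G ws = g"
  then obtain ws where ws: "ws \<in> words_over G S" "length ws \<le> n" "word_eval G ws = g" by blast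
  then have "word_length G S g \<le> enat (length ws)"
    unfolding word_length_def by (intro INF_lower) simp
  also have "\<dots> \<le> enat n" using ws by simp
  finally show "g \<in> ball n" using ws word_eval_closed by (auto simp: word_ball_def)
qed

lemma ball_closed: "ball n \<subseteq> carrier G"
  by (auto simp: word_ball_def)

lemma ball_mono: "m \<le> n \<Longrightarrow> ball m \<subseteq> ball n"
  unfolding subset_iff ball_iff by (blast intro: le_trans)

lemma ball_zero: "ball 0 = {\<one>}"
  by (auto simp: ball_iff words_over_def word_eval_def intro!: bexI[of _ "[]"])

lemma one_in_ball: "\<one> \<in> ball n"
  using ball_mono[of 0 n] ball_zero by auto

lemma ball_mult:
  assumes "x \<in> ball m" "y \<in> ball n"
  shows "x \<otimes> y \<in> ball (m + n)"
proof -
  obtain us vs where "us \<in> words_over G S" "length us \<le> m" "word_eval G us = x"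
    "vs \<in> words_over G S" "length vs \<le> n" "word_eval G vs = y"
    using assms by (auto simp: ball_iff)
  then show ?thesis
    unfolding ball_iff
    by (intro bexI[of _ "us @ vs"]) (auto simp: word_eval_append words_over_def)
qed

lemma ball_split:
  assumes "x \<in> ball (m + n)"
  obtains y z where "y \<in> ball m" "z \<in> ball n" "x = y \<otimes> z"
proof -
  obtain ws where ws: "ws \<in> words_over G S" "length ws \<le> m + n" "word_eval G ws = x"
    using assms by (auto simp: ball_iff)
  have *: "take m ws \<in> words_over G S" "drop m ws \<in> words_over G S"
    using ws(1) unfolding words_over_def by (auto dest: in_set_takeD in_set_dropD)
  show ?thesis
  proof (rule that)
    show "word_eval G (take m ws) \<in> ball m" "word_eval G (drop m ws) \<in> ball n"
      using * ws(2) by (auto simp: ball_iff intro!: bexI)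
    show "x = word_eval G (take m ws) \<otimes> word_eval G (drop m ws)"
      using word_eval_append[OF *] ws(3) by simp
  qed
qed

lemma gen_in_ball: "x \<in> S \<union> m_inv G ` S \<Longrightarrow> x \<in> ball 1"
  unfolding ball_iff using gens_closed
  by (intro bexI[of _ "[x]"]) (auto simp: words_over_def word_eval_def)

lemma ball_inv:
  assumes "x \<in> ball n"
  shows "inv x \<in> ball n"
  using assms
proof (induction n arbitrary: x)
  case 0
  then show ?case by (simp add: ball_zero)
next
  case (Suc n)
  have one: "inv z \<in> ball 1" if "z \<in> ball 1" for z
  proof -
    obtain ws where ws: "ws \<in> words_over G S" "length ws \<le> 1" "word_eval G ws = z"
      using \<open>z \<in> ball 1\<close> by (auto simp: ball_iff)
    show ?thesis
    proof (cases ws)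
      case Nil
      then show ?thesis using ws one_in_ball[of 1] by (auto simp: word_eval_def)
    next
      case (Cons s vs)
      then have s: "s \<in> S \<union> m_inv G ` S" and z: "z = s"
        using ws gens_closed by (auto simp: words_over_def word_eval_def)
      have "inv s \<in> S \<union> m_inv G ` S"
        using s gens_closed by auto
      then show ?thesis using z gen_in_ball by blast
    qed
  qed
  obtain y z where yz: "y \<in> ball n" "z \<in> ball 1" "x = y \<otimes> z"
    using ball_split[of x n 1] Suc.prems by auto
  have "inv z \<otimes> inv y \<in> ball (1 + n)"
    using yz Suc.IH one by (intro ball_mult) auto
  then show ?case using yz ball_closed by (simp add: inv_mult_group subset_iff)
qed

lemma finite_ball: "finite (ball n)"
proof -
  have "ball n \<subseteq> word_eval G ` {ws. set ws \<subseteq> S \<union> m_inv G ` S \<and> length ws \<le> n}"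
  proof
    fix g assume "g \<in> ball n"
    then obtain ws where "ws \<in> words_over G S" "length ws \<le> n" "g = word_eval G ws"
      unfolding ball_iff by blast
    then show "g \<in> word_eval G ` {ws. set ws \<subseteq> S \<union> m_inv G ` S \<and> length ws \<le> n}"
      by (intro image_eqI[of _ _ ws]) (auto simp: words_over_def)
  qed
  moreover have "finite {ws. set ws \<subseteq> S \<union> m_inv G ` S \<and> length ws \<le> n}"
    using fgs by (intro finite_lists_length_le) (auto simp: finite_generating_set_def)
  ultimately show ?thesis using finite_surj by blast
qed

lemma growth_pos: "growth n > 0"
  using one_in_ball finite_ball by (auto simp: card_gt_0_iff)

lemma growth_mono: "m \<le> n \<Longrightarrow> growth m \<le> growth n"
  by (intro card_mono finite_ball ball_mono)

lemma ex_ball: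
  assumes "g \<in> carrier G"
  shows "\<exists>n. g \<in> ball n"
proof -
  have "g \<in> generate G S" using assms fgs by (simp add: finite_generating_set_def)
  then show ?thesis
  proof induction
    case one
    then show ?case using one_in_ball by blast
  next
    case (incl h)
    then show ?case using gen_in_ball by blast
  next
    case (inv h)
    then show ?case using gen_in_ball by blast
  next
    case (eng h1 h2)
    then show ?case using ball_mult by blast
  qed
qed

lemma finite_subset_ball:
  assumes "finite F" "F \<subseteq> carrier G"
  shows "\<exists>n. F \<subseteq> ball n"
  using assms
proof induction
  case (insert x F)
  then obtain m n where "F \<subseteq> ball m" "x \<in> ball n" using ex_ball by blast
  then have "insert x F \<subseteq> ball (max m n)"
    using ball_mono[of m "max m n"] ball_mono[of n "max m n"] by auto
  then show ?case by blast
qed simp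


text \<open>Shift each point of the outer shell inwards by \<open>3 k\<close> along a geodesic to the identity: the
  ball of radius \<open>k\<close> around the shifted point lies in the next shell, and every point of that
  shell is covered by at most \<open>growth (4 * k)\<close> of these balls.\<close>

lemma card_shell_le:
  assumes "5 * k \<le> r"
  shows "card (ball r - ball (r - k)) * growth k
    \<le> card (ball (r - k) - ball (r - 5 * k)) * growth (4 * k)"
proof -
  define O' where "O' = ball r - ball (r - k)"
  have "\<exists>y\<in>ball (r - 3 * k). \<exists>u\<in>ball (3 * k). z = y \<otimes> u" if "z \<in> O'" for z
  proof -
    have "z \<in> ball (r - 3 * k + 3 * k)" using assms \<open>z \<in> O'\<close> by (simp add: O'_def)
    then show ?thesis by (rule ball_split) blast
  qed
  then obtain y where y: "\<And>z. z \<in> O' \<Longrightarrow> y z \<in> ball (r - 3 * k)"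
    and u: "\<And>z. z \<in> O' \<Longrightarrow> \<exists>u\<in>ball (3 * k). z = y z \<otimes> u"
    by metis
  have y': "inv (y z) \<otimes> z \<in> ball (3 * k)" if "z \<in> O'" for z
  proof -
    obtain u where "u \<in> ball (3 * k)" "z = y z \<otimes> u" using u \<open>z \<in> O'\<close> by blast
    moreover have "y z \<in> carrier G" "u \<in> carrier G" using y that calculation ball_closed by blast+
    ultimately show ?thesis by (metis inv_cancel_left(1))
  qed
  have z_closed: "z \<in> carrier G" "y z \<in> carrier G" if "z \<in> O'" for z
    using that y ball_closed by (auto simp: O'_def)
  \<comment> \<open>\<open>f\<close> records the point \<open>y z \<otimes> v\<close> and the
    displacement from it to \<open>z\<close>. The product of both entries is \<open>z\<close>; this
    fixes \<open>y z\<close>, and then \<open>v\<close> by cancellation.\<close>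
  define f where "f = (\<lambda>(z, v). (y z \<otimes> v, inv (y z \<otimes> v) \<otimes> z))"
  have inj: "inj_on f (O' \<times> ball k)"
  proof (rule inj_onI, clarify)
    fix z v z' v'
    assume *: "z \<in> O'" "v \<in> ball k" "z' \<in> O'" "v' \<in> ball k" "f (z, v) = f (z', v')"
    then have c: "v \<in> carrier G" "v' \<in> carrier G" using ball_closed by blast+
    have eq: "y z \<otimes> v = y z' \<otimes> v'" "inv (y z \<otimes> v) \<otimes> z = inv (y z' \<otimes> v') \<otimes> z'"
      using * by (auto simp: f_def)
    then have "z = z'" using c z_closed[OF *(1)] z_closed[OF *(3)] by (metis inv_cancel_left(2) m_closed)
    then show "z = z' \<and> v = v'" using eq c z_closed[OF *(1)] by simp
  qed
  have img: "f ` (O' \<times> ball k) \<subseteq> (ball (r - k) - ball (r - 5 * k)) \<times> ball (4 * k)"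
  proof (clarsimp simp: f_def, intro conjI)
    fix z v assume z: "z \<in> O'" and v: "v \<in> ball k"
    have c: "z \<in> carrier G" "y z \<in> carrier G" "v \<in> carrier G"
      using z_closed z v ball_closed by blast+
    have "y z \<otimes> v \<in> ball (r - 3 * k + k)" by (rule ball_mult[OF y[OF z] v])
    then show "y z \<otimes> v \<in> ball (r - k)" using ball_mono[of "r - 3 * k + k" "r - k"] assms
      by (simp add: subset_iff)
    \<comment> \<open>Walking from \<open>y z \<otimes> v\<close> back to \<open>y z\<close> and on
      to \<open>z\<close> takes at most \<open>k + 3 * k\<close> steps, so a point this deep would
      put \<open>z\<close> into \<open>ball (r - k)\<close>.\<close>
    show "y z \<otimes> v \<notin> ball (r - 5 * k)"
    proof
      assume "y z \<otimes> v \<in> ball (r - 5 * k)"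
      then have "(y z \<otimes> v) \<otimes> inv v \<in> ball (r - 5 * k + k)"
        by (rule ball_mult) (rule ball_inv[OF v])
      then have "(y z \<otimes> v) \<otimes> inv v \<otimes> (inv (y z) \<otimes> z) \<in> ball (r - 5 * k + k + 3 * k)"
        by (rule ball_mult) (rule y'[OF z])
      moreover have "(y z \<otimes> v) \<otimes> inv v \<otimes> (inv (y z) \<otimes> z) = z"
        using c by (simp add: m_assoc inv_cancel_left)
      moreover have "r - 5 * k + k + 3 * k = r - k" using assms by simp
      ultimately show False using z by (simp add: O'_def)
    qed
    have "inv v \<otimes> (inv (y z) \<otimes> z) \<in> ball (k + 3 * k)"
      by (rule ball_mult[OF ball_inv[OF v] y'[OF z]])
    then show "inv (y z \<otimes> v) \<otimes> z \<in> ball (4 * k)"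
      using c by (simp add: inv_mult_group m_assoc)
  qed
  have "card (O' \<times> ball k) = card (f ` (O' \<times> ball k))" by (simp add: card_image inj)
  also have "\<dots> \<le> card ((ball (r - k) - ball (r - 5 * k)) \<times> ball (4 * k))"
    by (rule card_mono[OF _ img]) (simp add: finite_ball)
  finally show ?thesis by (simp add: O'_def card_cartesian_product)
qed

section \<open>From doubling to thin spheres and stable growth\<close>

lemma growth_diff:
  assumes "m \<le> n"
  shows "real (card (ball n - ball m)) = real (growth n) - growth m"
  using card_Diff_subset[OF finite_ball ball_mono[OF assms]] growth_mono[OF assms] by simp

text \<open>By \<open>card_shell_le\<close> and doubling, the outer shell \<open>D\<close> of width
  \<open>k\<close> and the next one \<open>E\<close> satisfy \<open>D \<le> K * E\<close>, so
  \<open>D + E\<close>, the shell of width \<open>5 * k\<close>, has at least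
  \<open>(1 + 1 / K) * D\<close> points. Starting from the sphere of radius \<open>r\<close>, this
  can be repeated \<open>j\<close> times within the ball.\<close>

lemma doubling_growth_sphere:
  assumes doubling: "\<And>n. growth (4 * n) \<le> K * growth n" and "K > 0" and "5 ^ j \<le> r"
  shows "(real (growth r) - growth (r - 1)) * (1 + 1 / K) ^ j \<le> real (growth r)"
proof -
  have step: "(real (growth r) - growth (r - k)) * (1 + 1 / K) \<le> real (growth r) - growth (r - 5 * k)"
    if "5 * k \<le> r" for k
  proof -
    let ?D = "real (growth r) - growth (r - k)"
    let ?E = "real (growth (r - k)) - growth (r - 5 * k)"
    have "real (card (ball r - ball (r - k))) * growth k
        \<le> real (card (ball (r - k) - ball (r - 5 * k))) * growth (4 * k)"
      using card_shell_le[OF that] unfolding of_nat_mult[symmetric] of_nat_le_iff .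
    then have "?D * growth k \<le> ?E * growth (4 * k)"
      by (simp add: growth_diff)
    also have "\<dots> \<le> ?E * (K * growth k)"
      using doubling[of k] growth_mono[of "r - 5 * k" "r - k"]
      by (intro mult_left_mono) (simp_all flip: of_nat_mult)
    finally have "?D * growth k \<le> (K * ?E) * growth k" by (simp add: mult_ac)
    then have "?D \<le> K * ?E" using growth_pos[of k] by simp
    then have "?D / K \<le> ?E" using \<open>K > 0\<close> by (simp add: pos_divide_le_eq mult.commute)
    then show ?thesis by (simp add: distrib_left)
  qed
  have "(real (growth r) - growth (r - 1)) * (1 + 1 / K) ^ j \<le> real (growth r) - growth (r - 5 ^ j)"
    using \<open>5 ^ j \<le> r\<close>
  proof (induction j)
    case (Suc j)
    then have "(real (growth r) - growth (r - 1)) * (1 + 1 / K) ^ j \<le> real (growth r) - growth (r - 5 ^ j)"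
      by simp
    then have "(real (growth r) - growth (r - 1)) * (1 + 1 / K) ^ j * (1 + 1 / K)
        \<le> (real (growth r) - growth (r - 5 ^ j)) * (1 + 1 / K)"
      by (rule mult_right_mono) simp
    then have "(real (growth r) - growth (r - 1)) * (1 + 1 / K) ^ Suc j
        \<le> (real (growth r) - growth (r - 5 ^ j)) * (1 + 1 / K)"
      by (simp only: power_Suc mult_ac)
    also have "\<dots> \<le> real (growth r) - growth (r - 5 ^ Suc j)"
      using step[of "5 ^ j"] Suc.prems by simp
    finally show ?case .
  qed simp
  then show ?thesis by simp
qed

text \<open>Once the radius exceeds \<open>5 ^ j\<close>, the sphere is at most a fraction
  \<open>1 / (1 + 1 / K) ^ j\<close> of the ball, and \<open>j\<close> is arbitrary. The case of
  general \<open>L\<close> is a telescoping product of one-step quotients.\<close>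

lemma doubling_growth_ratio:
  assumes doubling: "\<And>n. growth (4 * n) \<le> K * growth n" and "K > 0"
  shows "(\<lambda>n. growth (n + L) / growth n) \<longlonglongrightarrow> 1"
proof -
  have "(\<lambda>n. (real (growth (Suc n)) - growth n) / growth (Suc n)) \<longlonglongrightarrow> 0"
  proof (rule LIMSEQ_I)
    fix e :: real assume "e > 0"
    obtain j where j: "1 / e < (1 + 1 / K) ^ j"
      using real_arch_pow[of "1 + 1 / K" "1 / e"] \<open>K > 0\<close> by auto
    have "norm ((real (growth (Suc n)) - growth n) / growth (Suc n) - 0) < e" if "n \<ge> 5 ^ j" for n
    proof -
      have d: "real (growth (Suc n)) - growth n \<ge> 0" using growth_mono[of n "Suc n"] by simp
      have "(real (growth (Suc n)) - growth n) * (1 + 1 / K) ^ j \<le> real (growth (Suc n))"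
        using doubling_growth_sphere[OF doubling \<open>K > 0\<close>, of j "Suc n"] that by simp
      then have "(real (growth (Suc n)) - growth n) / growth (Suc n) \<le> 1 / (1 + 1 / K) ^ j"
        using \<open>K > 0\<close> growth_pos[of "Suc n"] by (simp add: pos_le_divide_eq pos_divide_le_eq add_pos_pos)
      also have "\<dots> < e" using j \<open>e > 0\<close> \<open>K > 0\<close>
        by (simp add: pos_divide_less_eq add_pos_pos mult.commute)
      finally show ?thesis using d by simp
    qed
    then show "\<exists>N. \<forall>n\<ge>N. norm ((real (growth (Suc n)) - growth n) / growth (Suc n) - 0) < e"
      by blast
  qed
  \<comment> \<open>The fraction is relative to the larger ball, so \<open>1\<close> minus it is
    \<open>growth n / growth (Suc n)\<close>, which has to be inverted.\<close>
  then have "(\<lambda>n. inverse (1 - (real (growth (Suc n)) - growth n) / growth (Suc n))) \<longlonglongrightarrow> inverse (1 - 0)"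
    by (intro tendsto_intros) auto
  moreover have "inverse (1 - (real (growth (Suc n)) - growth n) / growth (Suc n))
      = growth (Suc n) / growth n" for n
    using growth_pos[of n] growth_pos[of "Suc n"]
    by (simp add: diff_divide_distrib)
  ultimately have one: "(\<lambda>n. growth (Suc n) / growth n) \<longlonglongrightarrow> 1" by simp
  show ?thesis
  proof (induction L)
    case 0
    then show ?case using growth_pos by (simp add: less_imp_neq[symmetric])
  next
    case (Suc L)
    have "(\<lambda>n. growth (Suc (n + L)) / growth (n + L)) \<longlonglongrightarrow> 1"
      using LIMSEQ_ignore_initial_segment[OF one] by simp
    from tendsto_mult[OF this Suc] show ?case
      using growth_pos by (simp add: less_imp_neq[symmetric])
  qed
qed

end


section \<open>Conjugacy classes\<close>

context group
begin

text \<open>With conjugators on this side, \<open>inv g \<otimes> x \<otimes> g\<close> depends only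
  on the right coset \<open>N #> g\<close> whenever \<open>N\<close> centralizes \<open>x\<close>.
  The orbits of the opposite convention are the same sets.\<close>

definition cls :: "'a \<Rightarrow> 'a set" where
  "cls x = (\<lambda>g. inv g \<otimes> x \<otimes> g) ` carrier G"

lemma conjugacy_classes_eq: "conjugacy_classes G = cls ` carrier G"
proof -
  have "orbit G (\<lambda>g. \<lambda>h\<in>carrier G. g \<otimes> h \<otimes> inv g) x = cls x" if "x \<in> carrier G" for x
  proof
    show "orbit G (\<lambda>g. \<lambda>h\<in>carrier G. g \<otimes> h \<otimes> inv g) x \<subseteq> cls x"
    proof
      fix y assume "y \<in> orbit G (\<lambda>g. \<lambda>h\<in>carrier G. g \<otimes> h \<otimes> inv g) x"
      then obtain g where "g \<in> carrier G" "y = g \<otimes> x \<otimes> inv g"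
        using \<open>x \<in> carrier G\<close> by (auto simp: orbit_def)
      then show "y \<in> cls x" unfolding cls_def by (intro image_eqI[of _ _ "inv g"]) auto
    qed
    show "cls x \<subseteq> orbit G (\<lambda>g. \<lambda>h\<in>carrier G. g \<otimes> h \<otimes> inv g) x"
    proof
      fix y assume "y \<in> cls x"
      then obtain g where "g \<in> carrier G" "y = inv g \<otimes> x \<otimes> g" by (auto simp: cls_def)
      then show "y \<in> orbit G (\<lambda>g. \<lambda>h\<in>carrier G. g \<otimes> h \<otimes> inv g) x"
        using that unfolding orbit_def by (intro CollectI exI[of _ "inv g"]) auto
    qed
  qed
  then show ?thesis
    by (auto simp: conjugacy_classes_def orbits_def)
qed

lemma cls_closed: "x \<in> carrier G \<Longrightarrow> cls x \<subseteq> carrier G"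
  by (auto simp: cls_def)

lemma mem_cls_self: "x \<in> carrier G \<Longrightarrow> x \<in> cls x"
  by (auto simp: cls_def intro!: image_eqI[of _ _ \<one>])

lemma conj_conj:
  assumes "g \<in> carrier G" "h \<in> carrier G" "x \<in> carrier G"
  shows "inv h \<otimes> (inv g \<otimes> x \<otimes> g) \<otimes> h = inv (g \<otimes> h) \<otimes> x \<otimes> (g \<otimes> h)"
  using assms by (simp add: inv_mult_group m_assoc)

lemma conj_inv_conj:
  assumes "g \<in> carrier G" "x \<in> carrier G"
  shows "inv (inv g) \<otimes> (inv g \<otimes> x \<otimes> g) \<otimes> inv g = x"
  using assms by (simp add: m_assoc inv_cancel_left)

lemma cls_subset:
  assumes "x \<in> carrier G" "y \<in> cls x"
  shows "cls y \<subseteq> cls x"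
proof
  fix z assume "z \<in> cls y"
  then obtain g h where "g \<in> carrier G" "y = inv g \<otimes> x \<otimes> g" "h \<in> carrier G" "z = inv h \<otimes> y \<otimes> h"
    using assms(2) by (auto simp: cls_def)
  then show "z \<in> cls x"
    using assms(1) conj_conj unfolding cls_def by (intro image_eqI[of _ _ "g \<otimes> h"]) auto
qed

lemma cls_eq:
  assumes "x \<in> carrier G" "y \<in> cls x"
  shows "cls y = cls x"
proof
  show "cls y \<subseteq> cls x" by (rule cls_subset[OF assms])
  obtain g where g: "g \<in> carrier G" "y = inv g \<otimes> x \<otimes> g" using assms(2) by (auto simp: cls_def)
  then have "x \<in> cls y"
    using conj_inv_conj[OF g(1) assms(1)] unfolding cls_def by (intro image_eqI[of _ _ "inv g"]) auto
  moreover have "y \<in> carrier G" using assms cls_closed by blast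
  ultimately show "cls x \<subseteq> cls y" by (intro cls_subset)
qed

section \<open>Conjugation by a transversal of a centralizing subgroup\<close>

lemma conj_rrep:
  assumes "subgroup N G" "x \<in> carrier G" "\<And>a. a \<in> N \<Longrightarrow> a \<otimes> x = x \<otimes> a" "g \<in> carrier G"
  shows "inv (rrep N g) \<otimes> x \<otimes> rrep N g = inv g \<otimes> x \<otimes> g"
proof -
  \<comment> \<open>In the factorization \<open>g = a \<otimes> r\<close>, the factor
    \<open>a \<in> N\<close> cancels because it commutes with \<open>x\<close>.\<close>
  define a r where "a = g \<otimes> inv (rrep N g)" and "r = rrep N g"
  have r: "r \<in> carrier G" using rrep_closed assms by (simp add: r_def)
  have a: "a \<in> N" using mult_inv_rrep assms by (simp add: a_def)
  then have ac: "a \<in> carrier G" using assms(1) subgroup.mem_carrier by metis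
  have g: "g = a \<otimes> r" using r assms(4) by (simp add: a_def r_def m_assoc)
  have "inv g \<otimes> x \<otimes> g = inv r \<otimes> (inv a \<otimes> (x \<otimes> a)) \<otimes> r"
    using r ac assms(2) by (simp add: g inv_mult_group m_assoc)
  also have "inv a \<otimes> (x \<otimes> a) = x"
    using assms(2) ac by (simp add: assms(3)[OF a, symmetric] inv_cancel_left)
  finally show ?thesis by (simp add: r_def)
qed

text \<open>One transversal serves all \<open>x\<close> centralized by \<open>N\<close>. If it is
  finite, it gives finite classes and a uniform bound on the length of conjugators.\<close>

lemma cls_eq_conj_rreps:
  assumes "subgroup N G" "x \<in> carrier G" "\<And>a. a \<in> N \<Longrightarrow> a \<otimes> x = x \<otimes> a"
  shows "cls x = (\<lambda>r. inv r \<otimes> x \<otimes> r) ` rreps N"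
proof
  show "cls x \<subseteq> (\<lambda>r. inv r \<otimes> x \<otimes> r) ` rreps N"
  proof
    fix y assume "y \<in> cls x"
    then obtain g where "g \<in> carrier G" "y = inv g \<otimes> x \<otimes> g" by (auto simp: cls_def)
    then show "y \<in> (\<lambda>r. inv r \<otimes> x \<otimes> r) ` rreps N"
      using conj_rrep[OF assms, of g]
      by (intro image_eqI[of _ _ "rrep N g"]) (auto simp: rreps_def)
  qed
  show "(\<lambda>r. inv r \<otimes> x \<otimes> r) ` rreps N \<subseteq> cls x"
    using rreps_closed[OF assms(1)] by (auto simp: cls_def)
qed

text \<open>Right multiplication by \<open>g\<close> permutes the right cosets of \<open>N\<close>,
  and it carries conjugators from \<open>x\<close> to \<open>y\<close> to conjugators from
  \<open>x\<close> to \<open>inv g \<otimes> y \<otimes> g\<close>.\<close>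

lemma card_conj_fibre_le:
  assumes N: "subgroup N G" "finite (rreps N)" and x: "x \<in> carrier G"
    and cent: "\<And>a. a \<in> N \<Longrightarrow> a \<otimes> x = x \<otimes> a" and g: "g \<in> carrier G"
  shows "card {r \<in> rreps N. inv r \<otimes> x \<otimes> r = y}
    \<le> card {r \<in> rreps N. inv r \<otimes> x \<otimes> r = inv g \<otimes> y \<otimes> g}"
proof (rule card_inj_on_le)
  let ?f = "\<lambda>r. rrep N (r \<otimes> g)"
  have rc: "r \<in> carrier G" if "r \<in> rreps N" for r using that rreps_closed[OF N(1)] by blast
  show "inj_on ?f {r \<in> rreps N. inv r \<otimes> x \<otimes> r = y}"
  proof (rule inj_onI)
    fix r s assume r: "r \<in> {r \<in> rreps N. inv r \<otimes> x \<otimes> r = y}"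
      and s: "s \<in> {r \<in> rreps N. inv r \<otimes> x \<otimes> r = y}" and eq: "?f r = ?f s"
    have "(r \<otimes> g) \<otimes> inv (s \<otimes> g) \<in> N" using eq rrep_eq_iff[OF N(1)] r s rc g by auto
    moreover have "(r \<otimes> g) \<otimes> inv (s \<otimes> g) = r \<otimes> inv s"
      using r s rc g by (simp add: inv_mult_group m_assoc inv_cancel_left)
    ultimately have "rrep N r = rrep N s" using rrep_eq_iff[OF N(1)] r s rc by auto
    then show "r = s" using rreps_rrep[OF N(1)] r s by auto
  qed
  show "?f ` {r \<in> rreps N. inv r \<otimes> x \<otimes> r = y}
      \<subseteq> {r \<in> rreps N. inv r \<otimes> x \<otimes> r = inv g \<otimes> y \<otimes> g}"
  proof clarify
    fix r assume r: "r \<in> rreps N"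
    have "inv (?f r) \<otimes> x \<otimes> ?f r = inv (r \<otimes> g) \<otimes> x \<otimes> (r \<otimes> g)"
      using r rc g by (intro conj_rrep[OF N(1) x cent]) auto
    also have "\<dots> = inv g \<otimes> (inv r \<otimes> x \<otimes> r) \<otimes> g" using r rc g x by (simp add: conj_conj)
    finally show "?f r \<in> rreps N \<and> inv (?f r) \<otimes> x \<otimes> ?f r = inv g \<otimes> (inv r \<otimes> x \<otimes> r) \<otimes> g"
      using r rc g by (simp add: rreps_def)
  qed
  show "finite {r \<in> rreps N. inv r \<otimes> x \<otimes> r = inv g \<otimes> y \<otimes> g}" using N(2) by simp
qed

text \<open>Orbit-stabilizer on the transversal: all fibres of
  \<open>r \<mapsto> inv r \<otimes> x \<otimes> r\<close> are equally large, by the previous lemma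
  applied to \<open>g\<close> and to \<open>inv g\<close>, and the fibre over \<open>x\<close>
  consists of the representatives commuting with \<open>x\<close>.\<close>

lemma card_cls_mult:
  assumes N: "subgroup N G" "finite (rreps N)" and x: "x \<in> carrier G"
    and cent: "\<And>a. a \<in> N \<Longrightarrow> a \<otimes> x = x \<otimes> a"
  shows "card (cls x) * card {r \<in> rreps N. x \<otimes> r = r \<otimes> x} = card (rreps N)"
proof -
  let ?c = "\<lambda>r. inv r \<otimes> x \<otimes> r"
  have rc: "r \<in> carrier G" if "r \<in> rreps N" for r using that rreps_closed[OF N(1)] by blast
  have cls: "cls x = ?c ` rreps N" by (rule cls_eq_conj_rreps[OF N(1) x cent])
  have fibre: "card {r \<in> rreps N. ?c r = y} = card {r \<in> rreps N. ?c r = x}" if y: "y \<in> cls x" for y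
  proof -
    obtain g where g: "g \<in> carrier G" "y = inv g \<otimes> x \<otimes> g" using y by (auto simp: cls_def)
    have "card {r \<in> rreps N. ?c r = x} \<le> card {r \<in> rreps N. ?c r = y}"
      using card_conj_fibre_le[OF N x cent g(1), of x] g(2) by simp
    moreover have "card {r \<in> rreps N. ?c r = y} \<le> card {r \<in> rreps N. ?c r = x}"
      using card_conj_fibre_le[OF N x cent, of "inv g" y] g conj_inv_conj[OF g(1) x] by simp
    ultimately show ?thesis by simp
  qed
  have "card (rreps N) = (\<Sum>r\<in>rreps N. 1)" by simp
  also have "\<dots> = (\<Sum>y\<in>cls x. \<Sum>r\<in>{r \<in> rreps N. ?c r = y}. 1)"
    unfolding cls by (rule sum.image_gen[OF N(2)])
  also have "\<dots> = (\<Sum>y\<in>cls x. card {r \<in> rreps N. ?c r = x})"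
    by (intro sum.cong refl) (simp add: fibre)
  also have "\<dots> = card (cls x) * card {r \<in> rreps N. ?c r = x}" by simp
  also have "{r \<in> rreps N. ?c r = x} = {r \<in> rreps N. x \<otimes> r = r \<otimes> x}"
  proof (intro Collect_cong conj_cong refl)
    fix r assume "r \<in> rreps N"
    then have r: "r \<in> carrier G" by (rule rc)
    show "(?c r = x) = (x \<otimes> r = r \<otimes> x)"
      using inv_solve_left[of "x" r "x \<otimes> r"] r x by (auto simp: m_assoc)
  qed
  finally show ?thesis by simp
qed

end

section \<open>Virtually abelian groups\<close>

text \<open>No generating set is fixed here, so constants defined in this locale depend on
  \<open>G\<close> and \<open>A\<close> only.\<close>

locale virtually_abelian_group = group G for G (structure) +
  fixes A :: "'a set"
  assumes A_subgroup: "subgroup A G"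
    and A_comm: "\<lbrakk>a \<in> A; b \<in> A\<rbrakk> \<Longrightarrow> a \<otimes> b = b \<otimes> a"
    and A_finite_index: "finite (rcosets A)"
begin

section \<open>The abelian subgroup and its boxes of exponents\<close>

lemma A_closed: "a \<in> A \<Longrightarrow> a \<in> carrier G"
  using subgroup.mem_carrier[OF A_subgroup] .

lemma A_mult: "\<lbrakk>a \<in> A; b \<in> A\<rbrakk> \<Longrightarrow> a \<otimes> b \<in> A"
  using subgroup.m_closed[OF A_subgroup] .

lemma A_inv: "a \<in> A \<Longrightarrow> inv a \<in> A"
  using subgroup.m_inv_closed[OF A_subgroup] .

lemma A_pow: "a \<in> A \<Longrightarrow> a [^] (n :: nat) \<in> A"
  by (induction n) (simp_all add: A_mult subgroup.one_closed[OF A_subgroup])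

text \<open>Exponents are natural numbers: the list used in \<open>ball_subset_box\<close> has
  separate entries for letters and inverse letters. Different exponents may give the same element,
  so boxes are compared by coverings and not by exact counts.\<close>

primrec box :: "'a list \<Rightarrow> nat \<Rightarrow> 'a set" where
  "box [] k = {\<one>}"
| "box (e # es) k = (\<lambda>(i :: nat, x). e [^] i \<otimes> x) ` ({..k} \<times> box es k)"

lemma box_subset: "set es \<subseteq> A \<Longrightarrow> box es k \<subseteq> A"
  by (induction es) (auto simp: subgroup.one_closed[OF A_subgroup] intro!: A_mult A_pow)

lemma finite_box: "finite (box es k)"
  by (induction es) auto

lemma box_mono: "m \<le> n \<Longrightarrow> box es m \<subseteq> box es n"
  by (induction es) (simp, simp, intro image_mono Sigma_mono, auto)

lemma one_in_box: "\<one> \<in> box es k"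
  by (induction es) (auto intro!: image_eqI[of _ _ "(0, \<one>)"])

text \<open>Since \<open>A\<close> is abelian, the new factor can be moved to its own place in the
  product, where it raises one exponent by one.\<close>

lemma box_mult:
  assumes "set es \<subseteq> A" "e \<in> set es" "x \<in> box es k"
  shows "x \<otimes> e \<in> box es (Suc k)"
  using assms
proof (induction es arbitrary: x)
  case (Cons d es)
  then obtain i :: nat and y where i: "i \<le> k" and y: "y \<in> box es k" and x: "x = d [^] i \<otimes> y"
    by auto
  have dA: "d \<in> A" "d [^] i \<in> A" and yA: "y \<in> A" and eA: "e \<in> A"
    using Cons.prems(1,2) y box_subset[of es k] A_pow by auto
  note c = dA[THEN A_closed] yA[THEN A_closed] eA[THEN A_closed]
  show ?case
  proof (cases "e = d")
    case True
    have "x \<otimes> e = d [^] i \<otimes> (y \<otimes> d)" using True x c by (simp add: m_assoc)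
    also have "\<dots> = d [^] Suc i \<otimes> y" using c A_comm[OF yA dA(1)] by (simp add: m_assoc)
    finally show ?thesis
      using i y box_mono[of k "Suc k" es] by (auto intro!: image_eqI[of _ _ "(Suc i, y)"])
  next
    case False
    then have "y \<otimes> e \<in> box es (Suc k)" using Cons.prems y by (intro Cons.IH) auto
    moreover have "x \<otimes> e = d [^] i \<otimes> (y \<otimes> e)" using x c by (simp add: m_assoc)
    ultimately show ?thesis using i by (auto intro!: image_eqI[of _ _ "(i, y \<otimes> e)"])
  qed
qed simp

text \<open>Divide every exponent by \<open>k\<close> with remainder. The quotients are at most
  \<open>q\<close>, which leaves \<open>Suc q\<close> choices per entry for the translation
  \<open>u\<close>; the remainders describe a point of \<open>box es k\<close>.\<close>

lemma box_scale:
  assumes "set es \<subseteq> A" "k > 0"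
  shows "\<exists>U\<subseteq>A. finite U \<and> card U \<le> Suc q ^ length es
    \<and> box es (q * k) \<subseteq> (\<lambda>(u, x). u \<otimes> x) ` (U \<times> box es k)"
  using assms(1)
proof (induction es)
  case Nil
  show ?case
    by (rule exI[of _ "{\<one>}"]) (simp add: subgroup.one_closed[OF A_subgroup])
next
  case (Cons e es)
  then obtain U where U: "U \<subseteq> A" "finite U" "card U \<le> Suc q ^ length es"
    "box es (q * k) \<subseteq> (\<lambda>(u, x). u \<otimes> x) ` (U \<times> box es k)" by auto
  have e: "e \<in> A" using Cons.prems by simp
  let ?V = "(\<lambda>(i, u). e [^] (k * i) \<otimes> u) ` ({..q} \<times> U)"
  have "?V \<subseteq> A" using U(1) e by (auto intro!: A_mult A_pow)
  moreover have "finite ?V" using U(2) by simp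
  moreover have "card ?V \<le> Suc q ^ length (e # es)"
  proof -
    have "card ?V \<le> card ({..q} \<times> U)" by (rule card_image_le) (simp add: U(2))
    also have "\<dots> = Suc q * card U" by (simp add: card_cartesian_product)
    also have "\<dots> \<le> Suc q * Suc q ^ length es" using U(3) by (rule mult_le_mono2)
    finally show ?thesis by simp
  qed
  moreover have "box (e # es) (q * k) \<subseteq> (\<lambda>(u, x). u \<otimes> x) ` (?V \<times> box (e # es) k)"
  proof
    fix z assume "z \<in> box (e # es) (q * k)"
    then obtain i :: nat and y where i: "i \<le> q * k" and y: "y \<in> box es (q * k)"
      and z: "z = e [^] i \<otimes> y" by auto
    obtain u x where u: "u \<in> U" and x: "x \<in> box es k" and yux: "y = u \<otimes> x"
      using y U(4) by auto
    have A: "u \<in> A" "x \<in> A" "e [^] (k * (i div k)) \<in> A" "e [^] (i mod k) \<in> A"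
      using u U(1) x box_subset[of es k] Cons.prems A_pow by auto
    note c = A[THEN A_closed] A_closed[OF e]
    have "e [^] i = e [^] (k * (i div k)) \<otimes> e [^] (i mod k)"
      using A_closed[OF e] by (simp add: nat_pow_mult)
    then have "z = e [^] (k * (i div k)) \<otimes> ((e [^] (i mod k) \<otimes> u) \<otimes> x)"
      using z yux c by (simp add: m_assoc)
    also have "e [^] (i mod k) \<otimes> u = u \<otimes> e [^] (i mod k)" by (rule A_comm[OF A(4,1)])
    finally have z': "z = (e [^] (k * (i div k)) \<otimes> u) \<otimes> (e [^] (i mod k) \<otimes> x)"
      using c by (simp add: m_assoc)
    have "i div k \<le> q" using i \<open>k > 0\<close> by (metis div_le_mono nonzero_mult_div_cancel_right not_gr0)
    then have V: "e [^] (k * (i div k)) \<otimes> u \<in> ?V" using u by auto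
    have "i mod k \<le> k" using \<open>k > 0\<close> by (simp add: less_imp_le)
    then have B: "e [^] (i mod k) \<otimes> x \<in> box (e # es) k" using x by auto
    show "z \<in> (\<lambda>(u, x). u \<otimes> x) ` (?V \<times> box (e # es) k)"
      unfolding z' by (rule image_eqI[OF _ SigmaI[OF V B]]) simp
  qed
  ultimately show ?case by blast
qed

lemma card_box_scale:
  assumes "set es \<subseteq> A" "k > 0"
  shows "card (box es (q * k)) \<le> Suc q ^ length es * card (box es k)"
proof -
  obtain U where U: "finite U" "card U \<le> Suc q ^ length es"
    "box es (q * k) \<subseteq> (\<lambda>(u, x). u \<otimes> x) ` (U \<times> box es k)"
    using box_scale[OF assms] by blast
  have "card (box es (q * k)) \<le> card (U \<times> box es k)"
    by (rule surj_card_le[OF _ U(3)]) (simp add: U(1) finite_box)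
  also have "\<dots> \<le> Suc q ^ length es * card (box es k)"
    using U(2) by (simp add: card_cartesian_product)
  finally show ?thesis .
qed

section \<open>The FC-center and the part of \<open>A\<close> that centralizes it\<close>

definition tame_reps :: "'a set" where
  "tame_reps = {t \<in> rreps A. finite ((\<lambda>a. inv a \<otimes> t \<otimes> a) ` A)}"

text \<open>This is the intersection of \<open>A\<close> with the centralizer of
  \<open>fc_center\<close>. Expressed through finitely many \<open>t\<close>, it is visibly of
  finite index. It is the \<open>N\<close> of the overview, and \<open>fc_center\<close> is the
  \<open>F\<close>.\<close>

definition tame_centralizer :: "'a set" where
  "tame_centralizer = {a \<in> A. \<forall>t\<in>tame_reps. a \<otimes> t = t \<otimes> a}"

definition fc_center :: "'a set" where
  "fc_center = {x \<in> carrier G. finite (cls x)}"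

lemma fc_center_closed: "x \<in> fc_center \<Longrightarrow> x \<in> carrier G"
  by (simp add: fc_center_def)

lemma finite_rreps_A: "finite (rreps A)"
  by (rule finite_rreps[OF A_finite_index])

lemma tame_reps_closed: "t \<in> tame_reps \<Longrightarrow> t \<in> carrier G"
  using rreps_closed[OF A_subgroup] by (auto simp: tame_reps_def)

lemma commute_inv:
  assumes "a \<in> carrier G" "t \<in> carrier G" "a \<otimes> t = t \<otimes> a"
  shows "inv a \<otimes> t = t \<otimes> inv a"
proof -
  have "inv a \<otimes> (t \<otimes> a) \<otimes> inv a = t \<otimes> inv a"
    unfolding assms(3)[symmetric] using assms(1,2) by (simp add: inv_cancel_left)
  then show ?thesis using assms(1,2) by (simp add: m_assoc)
qed

lemma commute_mult:
  assumes "a \<in> carrier G" "b \<in> carrier G" "t \<in> carrier G" "a \<otimes> t = t \<otimes> a" "b \<otimes> t = t \<otimes> b"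
  shows "a \<otimes> b \<otimes> t = t \<otimes> (a \<otimes> b)"
  using assms by (metis m_assoc)

lemma tame_centralizer_subgroup: "subgroup tame_centralizer G"
proof (rule subgroupI)
  show "tame_centralizer \<subseteq> carrier G" by (auto simp: tame_centralizer_def A_closed)
  have "\<one> \<in> tame_centralizer"
    by (simp add: tame_centralizer_def subgroup.one_closed[OF A_subgroup] tame_reps_closed)
  then show "tame_centralizer \<noteq> {}" by blast
  fix a assume a: "a \<in> tame_centralizer"
  then show "inv a \<in> tame_centralizer"
    by (auto simp: tame_centralizer_def A_inv A_closed tame_reps_closed commute_inv)
  fix b assume "b \<in> tame_centralizer"
  with a show "a \<otimes> b \<in> tame_centralizer"
    by (auto simp: tame_centralizer_def A_mult A_closed tame_reps_closed commute_mult)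
qed

text \<open>The \<open>A\<close>-part of \<open>x\<close> commutes with \<open>a\<close>, so only
  the representative is moved. The \<open>A\<close>-conjugates of \<open>x\<close> are thus a
  translate of those of \<open>rrep A x\<close>, which reduces questions about all \<open>x\<close>
  to finitely many representatives.\<close>

lemma conj_eq_split:
  assumes "x \<in> carrier G" "a \<in> A"
  shows "inv a \<otimes> x \<otimes> a = (x \<otimes> inv (rrep A x)) \<otimes> (inv a \<otimes> rrep A x \<otimes> a)"
proof -
  let ?b = "x \<otimes> inv (rrep A x)"
  have b: "?b \<in> A" using assms(1) by (rule mult_inv_rrep[OF A_subgroup])
  have t: "rrep A x \<in> carrier G" using assms(1) by (rule rrep_closed[OF A_subgroup])
  note c = A_closed[OF b] A_closed[OF assms(2)] t
  have "inv a \<otimes> x \<otimes> a = inv a \<otimes> ?b \<otimes> (rrep A x \<otimes> a)"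
    using c assms(1) by (simp add: m_assoc inv_cancel_left)
  also have "inv a \<otimes> ?b = ?b \<otimes> inv a" by (rule A_comm[OF A_inv[OF assms(2)] b])
  finally show ?thesis using c assms(1) by (simp add: m_assoc)
qed

text \<open>Translating back by the inverse of the \<open>A\<close>-part embeds the
  \<open>A\<close>-conjugates of the representative into a translate of
  \<open>cls x\<close>.\<close>

lemma rrep_fc_center:
  assumes "x \<in> fc_center"
  shows "rrep A x \<in> tame_reps"
proof -
  have x: "x \<in> carrier G" and fin: "finite (cls x)" using assms by (auto simp: fc_center_def)
  let ?t = "rrep A x" and ?b = "x \<otimes> inv (rrep A x)"
  have t: "?t \<in> carrier G" by (rule rrep_closed[OF A_subgroup x])
  have "(\<lambda>a. inv a \<otimes> ?t \<otimes> a) ` A \<subseteq> (\<lambda>y. inv ?b \<otimes> y) ` cls x"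
  proof clarify
    fix a assume a: "a \<in> A"
    have "inv ?b \<otimes> (inv a \<otimes> x \<otimes> a) = inv a \<otimes> ?t \<otimes> a"
      unfolding conj_eq_split[OF x a] using x t A_closed[OF a] by (intro inv_cancel_left) auto
    then show "inv a \<otimes> ?t \<otimes> a \<in> (\<lambda>y. inv ?b \<otimes> y) ` cls x"
      using A_closed[OF a] by (auto simp: cls_def image_image intro!: image_eqI[of _ _ a])
  qed
  then have "finite ((\<lambda>a. inv a \<otimes> ?t \<otimes> a) ` A)" using fin finite_surj by blast
  then show ?thesis using x by (simp add: tame_reps_def rreps_def)
qed

text \<open>\<open>a\<close> commutes with both factors of \<open>x\<close>. The hypothesis is on
  \<open>rrep A x\<close> and not \<open>x \<in> fc_center\<close>, because
  \<open>fc_centerI\<close> derives the latter from this lemma.\<close>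

lemma tame_centralizer_commute:
  assumes "a \<in> tame_centralizer" "x \<in> carrier G" "rrep A x \<in> tame_reps"
  shows "a \<otimes> x = x \<otimes> a"
proof -
  have a: "a \<in> A" "a \<otimes> rrep A x = rrep A x \<otimes> a" using assms by (auto simp: tame_centralizer_def)
  have b: "x \<otimes> inv (rrep A x) \<in> A" by (rule mult_inv_rrep[OF A_subgroup assms(2)])
  have t: "rrep A x \<in> carrier G" by (rule rrep_closed[OF A_subgroup assms(2)])
  have x: "x \<otimes> inv (rrep A x) \<otimes> rrep A x = x" using assms(2) t by (simp add: m_assoc)
  have "x \<otimes> inv (rrep A x) \<otimes> rrep A x \<otimes> a = a \<otimes> (x \<otimes> inv (rrep A x) \<otimes> rrep A x)"
    by (rule commute_mult[OF A_closed[OF b] t A_closed[OF a(1)] A_comm[OF b a(1)] a(2)[symmetric]])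
  then show ?thesis unfolding x by (rule sym)
qed

text \<open>Two elements of \<open>G\<close> with the same \<open>A\<close>-coset and the same conjugates of all \<open>t \<in> tame_reps\<close>
  lie in the same coset of \<open>tame_centralizer\<close>.\<close>

lemma finite_rreps_tame_centralizer: "finite (rreps tame_centralizer)"
proof -
  let ?conj = "\<lambda>g t. inv g \<otimes> t \<otimes> g"
  have fin_conj: "finite (cls t)" if t: "t \<in> tame_reps" for t
  proof -
    \<comment> \<open>Conjugating by \<open>g = a \<otimes> r\<close> means conjugating by
      \<open>a \<in> A\<close> first, with finitely many results as \<open>t\<close> is tame, and
      then by one of finitely many \<open>r\<close>.\<close>
    have "cls t \<subseteq> (\<lambda>(y, r). ?conj r y) ` ((\<lambda>a. ?conj a t) ` A \<times> rreps A)"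
    proof
      fix y assume "y \<in> cls t"
      then obtain g where g: "g \<in> carrier G" "y = ?conj g t" by (auto simp: cls_def)
      let ?r = "rrep A g" and ?a = "g \<otimes> inv (rrep A g)"
      have r: "?r \<in> carrier G" "?r \<in> rreps A" using g rrep_closed[OF A_subgroup] by (auto simp: rreps_def)
      have a: "?a \<in> A" by (rule mult_inv_rrep[OF A_subgroup g(1)])
      have "?a \<otimes> ?r = g" using g r by (simp add: m_assoc)
      then have "y = ?conj ?r (?conj ?a t)"
        using conj_conj[OF A_closed[OF a] r(1) tame_reps_closed[OF t]] g(2) by simp
      then show "y \<in> (\<lambda>(y, r). ?conj r y) ` ((\<lambda>a. ?conj a t) ` A \<times> rreps A)"
        using a r(2) by (intro image_eqI[of _ _ "(?conj ?a t, ?r)"]) auto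
    qed
    moreover have "finite ((\<lambda>a. ?conj a t) ` A \<times> rreps A)"
      using t finite_rreps_A by (simp add: tame_reps_def)
    ultimately show ?thesis using finite_surj by blast
  qed
  have "finite tame_reps" using finite_rreps_A by (simp add: tame_reps_def)
  \<comment> \<open>Restricting to \<open>tame_reps\<close> makes the second entry a point of a
    finite product of finite classes.\<close>
  define f where "f = (\<lambda>g. (rrep A g, \<lambda>t\<in>tame_reps. ?conj g t))"
  have rc: "g \<in> carrier G" if "g \<in> rreps tame_centralizer" for g
    using that rreps_closed[OF tame_centralizer_subgroup] by blast
  have "inj_on f (rreps tame_centralizer)"
  proof (rule inj_onI)
    fix g h assume g: "g \<in> rreps tame_centralizer" and h: "h \<in> rreps tame_centralizer" and eq: "f g = f h"
    note c = rc[OF g] rc[OF h]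
    have "rrep A g = rrep A h" using eq by (simp add: f_def)
    then have A: "g \<otimes> inv h \<in> A" using rrep_eq_iff[OF A_subgroup] c by blast
    moreover have "g \<otimes> inv h \<otimes> t = t \<otimes> (g \<otimes> inv h)" if t: "t \<in> tame_reps" for t
    proof -
      have tc: "t \<in> carrier G" by (rule tame_reps_closed[OF t])
      have "restrict (?conj g) tame_reps t = restrict (?conj h) tame_reps t"
        using eq by (simp add: f_def)
      then have conj: "?conj g t = ?conj h t" using t by simp
      have "t \<otimes> (g \<otimes> inv h) = g \<otimes> (?conj g t) \<otimes> inv h"
        using c tc by (simp add: m_assoc inv_cancel_left)
      also have "\<dots> = g \<otimes> inv h \<otimes> t"
        unfolding conj using c tc by (simp add: m_assoc)
      finally show ?thesis by (rule sym)
    qed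
    ultimately have "g \<otimes> inv h \<in> tame_centralizer" by (simp add: tame_centralizer_def)
    then have "rrep tame_centralizer g = rrep tame_centralizer h"
      using rrep_eq_iff[OF tame_centralizer_subgroup] c by blast
    then show "g = h" using rreps_rrep[OF tame_centralizer_subgroup] g h by simp
  qed
  moreover have "f ` rreps tame_centralizer \<subseteq> rreps A \<times> (\<Pi>\<^sub>E t\<in>tame_reps. cls t)"
    using rc by (auto simp: f_def rreps_def cls_def)
  moreover have "finite (rreps A \<times> (\<Pi>\<^sub>E t\<in>tame_reps. cls t))"
    using finite_rreps_A fin_conj \<open>finite tame_reps\<close> by (intro finite_cartesian_product finite_PiE) auto
  ultimately show ?thesis using inj_on_finite by blast
qed

lemma fc_center_commute:
  "\<lbrakk>x \<in> fc_center; a \<in> tame_centralizer\<rbrakk> \<Longrightarrow> a \<otimes> x = x \<otimes> a"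
  using tame_centralizer_commute rrep_fc_center fc_center_closed by blast

text \<open>Converse of \<open>rrep_fc_center\<close>: \<open>x\<close> is centralized by a subgroup
  of finite index, so finitely many conjugators produce its whole class.\<close>

lemma fc_centerI:
  assumes "x \<in> carrier G" "rrep A x \<in> tame_reps"
  shows "x \<in> fc_center"
proof -
  have "cls x = (\<lambda>r. inv r \<otimes> x \<otimes> r) ` rreps tame_centralizer"
    using assms by (intro cls_eq_conj_rreps tame_centralizer_subgroup tame_centralizer_commute)
  then show ?thesis using assms(1) finite_rreps_tame_centralizer by (simp add: fc_center_def)
qed

lemma fc_center_subgroup: "subgroup fc_center G"
proof (rule subgroupI)
  show "fc_center \<subseteq> carrier G" by (auto simp: fc_center_def)
  have "cls \<one> = {\<one>}" by (auto simp: cls_def)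
  then have "\<one> \<in> fc_center" by (simp add: fc_center_def)
  then show "fc_center \<noteq> {}" by blast
  fix x assume x: "x \<in> fc_center"
  have "cls (inv x) \<subseteq> m_inv G ` cls x"
    using fc_center_closed[OF x] by (auto simp: cls_def image_image inv_mult_group m_assoc)
  then show "inv x \<in> fc_center"
    using x by (auto simp: fc_center_def intro: finite_surj)
  fix y assume y: "y \<in> fc_center"
  have "cls (x \<otimes> y) \<subseteq> (\<lambda>(u, v). u \<otimes> v) ` (cls x \<times> cls y)"
  proof
    fix z assume "z \<in> cls (x \<otimes> y)"
    then obtain g where g: "g \<in> carrier G" "z = inv g \<otimes> (x \<otimes> y) \<otimes> g" by (auto simp: cls_def)
    then have "z = (inv g \<otimes> x \<otimes> g) \<otimes> (inv g \<otimes> y \<otimes> g)"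
      using fc_center_closed[OF x] fc_center_closed[OF y] by (simp add: m_assoc inv_cancel_left)
    then show "z \<in> (\<lambda>(u, v). u \<otimes> v) ` (cls x \<times> cls y)"
      using g(1) by (auto simp: cls_def)
  qed
  then show "x \<otimes> y \<in> fc_center"
    using x y by (auto simp: fc_center_def intro: finite_subset)
qed

lemma fc_centralizer_subgroup:
  assumes "r \<in> carrier G"
  shows "subgroup {x \<in> fc_center. x \<otimes> r = r \<otimes> x} G"
proof (rule subgroupI)
  note F = fc_center_subgroup
  show "{x \<in> fc_center. x \<otimes> r = r \<otimes> x} \<subseteq> carrier G" by (auto simp: fc_center_def)
  have "\<one> \<in> {x \<in> fc_center. x \<otimes> r = r \<otimes> x}"
    using assms subgroup.one_closed[OF F] by simp
  then show "{x \<in> fc_center. x \<otimes> r = r \<otimes> x} \<noteq> {}" by blast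
  fix x assume x: "x \<in> {x \<in> fc_center. x \<otimes> r = r \<otimes> x}"
  then show "inv x \<in> {x \<in> fc_center. x \<otimes> r = r \<otimes> x}"
    using assms commute_inv fc_center_closed subgroup.m_inv_closed[OF F] by auto
  fix y assume "y \<in> {x \<in> fc_center. x \<otimes> r = r \<otimes> x}"
  with x show "x \<otimes> y \<in> {x \<in> fc_center. x \<otimes> r = r \<otimes> x}"
    using assms commute_mult fc_center_closed subgroup.m_closed[OF F] by auto
qed

lemma inverse_card_cls:
  assumes "x \<in> fc_center"
  shows "1 / card (cls x)
    = card {r \<in> rreps tame_centralizer. x \<otimes> r = r \<otimes> x} / card (rreps tame_centralizer)"
proof -
  have x: "x \<in> carrier G" using assms by (rule fc_center_closed)
  have "cls x \<noteq> {}" using mem_cls_self[OF x] by blast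
  then have "card (cls x) \<noteq> 0" using assms by (simp add: fc_center_def)
  moreover have "rreps tame_centralizer \<noteq> {}" by (auto simp: rreps_def)
  then have "card (rreps tame_centralizer) \<noteq> 0" using finite_rreps_tame_centralizer by simp
  moreover have "real (card (cls x)) * card {r \<in> rreps tame_centralizer. x \<otimes> r = r \<otimes> x}
      = card (rreps tame_centralizer)"
    using card_cls_mult[OF tame_centralizer_subgroup finite_rreps_tame_centralizer x] fc_center_commute[OF assms]
    by (simp flip: of_nat_mult)
  ultimately show ?thesis by (simp add: field_simps)
qed

text \<open>Since \<open>x = b \<otimes> t\<close> with \<open>t = rrep A x\<close> and \<open>b \<in> A\<close> has the \<open>A\<close>-conjugates
  \<open>b \<otimes> (inv a \<otimes> t \<otimes> a)\<close>, conjugators depending only on the finitely many \<open>t\<close> suffice.\<close>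

lemma uniform_conjugators:
  obtains E where "finite E" "E \<subseteq> A"
    "\<And>x. \<lbrakk>x \<in> carrier G; x \<notin> fc_center\<rbrakk>
      \<Longrightarrow> \<exists>Y \<subseteq> (\<lambda>a. inv a \<otimes> x \<otimes> a) ` E. finite Y \<and> card Y = M"
proof -
  have "\<exists>E\<subseteq>A. finite E \<and> card ((\<lambda>a. inv a \<otimes> t \<otimes> a) ` E) = M" if t: "t \<in> rreps A - tame_reps" for t
  proof -
    have "infinite ((\<lambda>a. inv a \<otimes> t \<otimes> a) ` A)" using t by (simp add: tame_reps_def)
    then obtain Y where Y: "finite Y" "card Y = M" "Y \<subseteq> (\<lambda>a. inv a \<otimes> t \<otimes> a) ` A"
      using infinite_arbitrarily_large by blast
    then show ?thesis using finite_subset_image[OF Y(1,3)] by blast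
  qed
  then obtain E where E: "\<And>t. t \<in> rreps A - tame_reps \<Longrightarrow>
      E t \<subseteq> A \<and> finite (E t) \<and> card ((\<lambda>a. inv a \<otimes> t \<otimes> a) ` E t) = M"
    by metis
  let ?U = "\<Union>t\<in>rreps A - tame_reps. E t"
  show ?thesis
  proof (rule that)
    show "finite ?U" using E finite_rreps_A by blast
    show "?U \<subseteq> A" using E by blast
    fix x assume x: "x \<in> carrier G" "x \<notin> fc_center"
    let ?t = "rrep A x" and ?b = "x \<otimes> inv (rrep A x)"
    have t: "?t \<in> rreps A - tame_reps" using x fc_centerI by (auto simp: rreps_def)
    have tc: "?t \<in> carrier G" by (rule rrep_closed[OF A_subgroup x(1)])
    let ?Y = "(\<lambda>a. inv a \<otimes> x \<otimes> a) ` E ?t"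
    \<comment> \<open>Left translation by \<open>?b\<close> is injective, so the \<open>M\<close>
      distinct conjugates of \<open>?t\<close> give \<open>M\<close> distinct conjugates of
      \<open>x\<close>.\<close>
    have "?Y = (\<lambda>y. ?b \<otimes> y) ` (\<lambda>a. inv a \<otimes> ?t \<otimes> a) ` E ?t"
      unfolding image_image using E[OF t] by (intro image_cong refl conj_eq_split[OF x(1)]) auto
    moreover have "inj_on (\<lambda>y. ?b \<otimes> y) ((\<lambda>a. inv a \<otimes> ?t \<otimes> a) ` E ?t)"
    proof (rule inj_on_subset)
      show "inj_on (\<lambda>y. ?b \<otimes> y) (carrier G)" using x(1) tc by (intro inj_onI) simp
      show "(\<lambda>a. inv a \<otimes> ?t \<otimes> a) ` E ?t \<subseteq> carrier G"
        using E[OF t] tc A_closed by auto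
    qed
    ultimately have "card ?Y = M" using E[OF t] by (simp only: card_image)
    moreover have "finite ?Y" using E[OF t] by simp
    moreover have "?Y \<subseteq> (\<lambda>a. inv a \<otimes> x \<otimes> a) ` ?U" using t by blast
    ultimately show "\<exists>Y \<subseteq> (\<lambda>a. inv a \<otimes> x \<otimes> a) ` ?U. finite Y \<and> card Y = M" by blast
  qed
qed

text \<open>The average, over cosets of \<open>tame_centralizer\<close>, of the density of the
  elements of \<open>fc_center\<close> commuting with \<open>r\<close>. Where that subgroup has
  infinite index, \<open>card\<close> is 0 and \<open>1 / 0 = 0\<close> is the correct
  density.\<close>

definition mean_inverse_class_size :: real where
  "mean_inverse_class_size =
    (\<Sum>r\<in>rreps tame_centralizer. 1 / card (rreps {x \<in> fc_center. x \<otimes> r = r \<otimes> x}))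
      / card (rreps tame_centralizer)"

end

section \<open>Growth and densities\<close>

locale fin_gen_virtually_abelian_group = fin_gen_group + virtually_abelian_group
begin

section \<open>Comparison of balls with boxes\<close>

lemma pow_in_ball: "e \<in> ball L \<Longrightarrow> e [^] (i :: nat) \<in> ball (L * i)"
proof (induction i)
  case (Suc i)
  then have "e [^] i \<otimes> e \<in> ball (L * i + L)" by (intro ball_mult) auto
  then show ?case by (simp add: add.commute)
qed (simp add: ball_zero)

lemma box_subset_ball:
  assumes "set es \<subseteq> ball L"
  shows "box es k \<subseteq> ball (length es * L * k)"
  using assms
proof (induction es)
  case (Cons e es)
  show ?case
  proof clarsimp
    fix i x assume i: "i \<le> k" and x: "x \<in> box es k"
    have "e [^] i \<in> ball (L * i)" using Cons.prems by (intro pow_in_ball) auto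
    moreover have "x \<in> ball (length es * L * k)" using Cons x by auto
    ultimately have "e [^] i \<otimes> x \<in> ball (L * i + length es * L * k)" by (rule ball_mult)
    moreover have "L * i + length es * L * k \<le> (L + length es * L) * k"
      using i by (simp add: distrib_right)
    ultimately show "e [^] i \<otimes> x \<in> ball ((L + length es * L) * k)" using ball_mono by blast
  qed
qed (simp add: one_in_ball)

text \<open>Schreier rewriting: reading a word letter by letter while keeping the representative
  \<open>t\<close> of the current coset, each letter contributes one element of \<open>A\<close>, so
  exponents stay at most \<open>n\<close>. The factor \<open>inv (rrep A \<one>)\<close> corrects
  for the representative of \<open>A\<close> not being \<open>\<one>\<close>.\<close>

lemma ball_subset_box:
  obtains es where "set es \<subseteq> A"
    "\<And>n. ball n \<subseteq> (\<lambda>(x, t). inv (rrep A \<one>) \<otimes> x \<otimes> t) ` (box es n \<times> rreps A)"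
proof -
  have fin: "finite (rreps A)" by (rule finite_rreps[OF A_finite_index])
  define E where "E = (\<lambda>(t, x). t \<otimes> x \<otimes> inv (rrep A (t \<otimes> x))) ` (rreps A \<times> ball 1)"
  have "finite E" using fin finite_ball by (simp add: E_def)
  then obtain es where es: "set es = E" using finite_list by blast
  have sub: "set es \<subseteq> A"
  proof -
    have "t \<otimes> x \<otimes> inv (rrep A (t \<otimes> x)) \<in> A" if "t \<in> rreps A" "x \<in> ball 1" for t x
      using that rreps_closed[OF A_subgroup] ball_closed by (intro mult_inv_rrep[OF A_subgroup]) blast
    then show ?thesis by (auto simp: es E_def)
  qed
  have ex: "\<exists>x\<in>box es n. g = inv (rrep A \<one>) \<otimes> x \<otimes> rrep A g" if "g \<in> ball n" for n g
    using that
  proof (induction n arbitrary: g)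
    case 0
    show ?case using one_in_box[of es 0] 0 rrep_closed[OF A_subgroup, of \<one>] by (auto simp: ball_zero intro!: bexI[of _ \<one>])
  next
    case (Suc n)
    then obtain y z where y: "y \<in> ball n" and z: "z \<in> ball 1" and g: "g = y \<otimes> z"
      using ball_split[of g n 1] by auto
    obtain x where x: "x \<in> box es n" and yx: "y = inv (rrep A \<one>) \<otimes> x \<otimes> rrep A y"
      using Suc.IH[OF y] by blast
    let ?t = "rrep A y"
    let ?e = "?t \<otimes> z \<otimes> inv (rrep A (?t \<otimes> z))"
    have c: "y \<in> carrier G" "z \<in> carrier G" using y z ball_closed by blast+
    have t: "?t \<in> carrier G" by (rule rrep_closed[OF A_subgroup c(1)])
    have tz: "rrep A (?t \<otimes> z) \<in> carrier G" using t c by (intro rrep_closed[OF A_subgroup]) auto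
    have xc: "x \<in> carrier G" using x box_subset[OF sub] A_closed by blast
    have oc: "inv (rrep A \<one>) \<in> carrier G" using rrep_closed[OF A_subgroup] by simp
    have "?e \<in> set es" using z c(1) by (auto simp: es E_def rreps_def)
    then have mem: "x \<otimes> ?e \<in> box es (Suc n)" by (rule box_mult[OF sub _ x])
    \<comment> \<open>\<open>?t\<close> and \<open>y\<close> lie in the same right coset of
      \<open>A\<close>, hence so do \<open>?t \<otimes> z\<close> and
      \<open>g = y \<otimes> z\<close>.\<close>
    have rep_eq: "rrep A (?t \<otimes> z) = rrep A g"
    proof -
      have "(g \<otimes> inv (?t \<otimes> z)) = y \<otimes> inv ?t"
        using c t g by (simp add: inv_mult_group m_assoc inv_cancel_left)
      then have "g \<otimes> inv (?t \<otimes> z) \<in> A" using mult_inv_rrep[OF A_subgroup c(1)] by simp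
      then show ?thesis using rrep_eq_iff[OF A_subgroup, of g "?t \<otimes> z"] c t g by simp
    qed
    have decomp: "g = inv (rrep A \<one>) \<otimes> (x \<otimes> ?e) \<otimes> rrep A (?t \<otimes> z)"
    proof -
      have "g = inv (rrep A \<one>) \<otimes> x \<otimes> ?t \<otimes> z"
        unfolding g by (rule arg_cong[OF yx, of "\<lambda>w. w \<otimes> z"])
      then show ?thesis using c t tz xc oc by (simp add: m_assoc)
    qed
    show ?case unfolding rep_eq[symmetric] using decomp mem by (rule bexI)
  qed
  show ?thesis
  proof (rule that[OF sub])
    fix n
    show "ball n \<subseteq> (\<lambda>(x, t). inv (rrep A \<one>) \<otimes> x \<otimes> t) ` (box es n \<times> rreps A)"
    proof
      fix g assume g: "g \<in> ball n"
      then obtain x where "x \<in> box es n" "g = inv (rrep A \<one>) \<otimes> x \<otimes> rrep A g" using ex by blast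
      moreover have "rrep A g \<in> rreps A" using g ball_closed by (auto simp: rreps_def)
      ultimately show "g \<in> (\<lambda>(x, t). inv (rrep A \<one>) \<otimes> x \<otimes> t) ` (box es n \<times> rreps A)"
        by (intro image_eqI[of _ _ "(x, rrep A g)"]) auto
    qed
  qed
qed

text \<open>The ball of radius \<open>4 * n\<close> is covered by boundedly many translates of a
  box, that box by boundedly many translates of one scaled down by \<open>8 * c\<close>, and the
  small box fits into \<open>ball n\<close>, since \<open>c\<close> bounds the length of its points
  per unit of \<open>k\<close>.\<close>

lemma growth_doubling: "\<exists>K>0. \<forall>n. growth (4 * n) \<le> K * growth n"
proof -
  obtain es where es: "set es \<subseteq> A"
    and cover: "\<And>n. ball n \<subseteq> (\<lambda>(x, t). inv (rrep A \<one>) \<otimes> x \<otimes> t) ` (box es n \<times> rreps A)"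
    using ball_subset_box by blast
  have fin: "finite (rreps A)" by (rule finite_rreps[OF A_finite_index])
  obtain L where L: "set es \<subseteq> ball L"
    using finite_subset_ball[of "set es"] es A_closed by blast
  define c where "c = Suc (length es * L)"
  define M where "M = Suc (8 * c) ^ length es * card (rreps A)"
  have large: "growth (4 * n) \<le> M * growth n" if "n \<ge> c" for n
  proof -
    define k where "k = n div c"
    have "k > 0" using that by (simp add: k_def c_def div_greater_zero_iff)
    \<comment> \<open>Rounding down in \<open>n div c\<close> loses at most a factor 2 because
      \<open>k > 0\<close>; this is why the scale is \<open>8 * c\<close> and not
      \<open>4 * c\<close>.\<close>
    have "n < c * Suc k" unfolding k_def
      by (metis c_def dividend_less_times_div mult_Suc_right zero_less_Suc add.commute)
    also have "\<dots> \<le> c * (2 * k)" using \<open>k > 0\<close> by (intro mult_le_mono2) simp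
    finally have n: "4 * n \<le> 8 * c * k" by simp
    have "growth (4 * n) \<le> growth (8 * c * k)" by (rule growth_mono[OF n])
    also have "\<dots> \<le> card (box es (8 * c * k) \<times> rreps A)"
      by (rule surj_card_le[OF _ cover]) (simp add: fin finite_box)
    also have "\<dots> = card (box es (8 * c * k)) * card (rreps A)" by (rule card_cartesian_product)
    also have "\<dots> \<le> Suc (8 * c) ^ length es * card (box es k) * card (rreps A)"
      by (intro mult_le_mono1 card_box_scale es \<open>k > 0\<close>)
    also have "card (box es k) \<le> growth n"
    proof (rule card_mono[OF finite_ball])
      have "length es * L * k \<le> c * k" by (simp add: c_def)
      also have "\<dots> \<le> n" by (simp add: k_def)
      finally show "box es k \<subseteq> ball n" using box_subset_ball[OF L] ball_mono by blast
    qed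
    finally show ?thesis by (simp add: M_def mult_ac)
  qed
  \<comment> \<open>The additive constant handles the finitely many radii below
    \<open>c\<close>.\<close>
  have "growth (4 * n) \<le> (M + growth (4 * c)) * growth n" for n
  proof (cases "n \<ge> c")
    case True
    then show ?thesis using large by (simp add: add_mult_distrib trans_le_add1)
  next
    case False
    then have "growth (4 * n) \<le> growth (4 * c)" by (intro growth_mono) simp
    also have "\<dots> \<le> growth (4 * c) * growth n" using growth_pos[of n] by simp
    finally show ?thesis by (simp add: add_mult_distrib)
  qed
  moreover have "M + growth (4 * c) > 0" using growth_pos by simp
  ultimately show ?thesis by blast
qed

section \<open>Limits of growth quotients and densities of subgroups\<close>

lemma growth_ratio: "(\<lambda>n. growth (n + L) / growth n) \<longlonglongrightarrow> 1"
  using growth_doubling doubling_growth_ratio by blast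

lemma growth_ratio_shift:
  fixes f :: "nat \<Rightarrow> real"
  assumes "(\<lambda>n. f n / growth n) \<longlonglongrightarrow> d"
  shows "(\<lambda>n. f (n + L) / growth n) \<longlonglongrightarrow> d"
proof -
  have "(\<lambda>n. f (n + L) / growth (n + L)) \<longlonglongrightarrow> d"
    by (rule LIMSEQ_ignore_initial_segment[OF assms])
  from tendsto_mult[OF this growth_ratio[of L]] show ?thesis
    using growth_pos by (simp add: less_imp_neq[symmetric])
qed

text \<open>\<open>L\<close> may depend on \<open>M\<close>: for a given \<open>e\<close>, a single
  \<open>M > 2 / e\<close> suffices, as \<open>growth (n + L)\<close> is eventually below
  \<open>2 * growth n\<close>.\<close>

lemma growth_ratio_tendsto_zero:
  fixes f :: "nat \<Rightarrow> nat"
  assumes "\<And>M. \<exists>L. \<forall>n. M * f n \<le> growth (n + L)"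
  shows "(\<lambda>n. f n / growth n) \<longlonglongrightarrow> 0"
proof (rule LIMSEQ_I)
  fix e :: real assume "e > 0"
  obtain M :: nat where M: "2 / e < M" using reals_Archimedean2 by blast
  have "M > 0" using M \<open>e > 0\<close> by (cases M) (auto simp: divide_less_0_iff)
  obtain L where L: "\<And>n. M * f n \<le> growth (n + L)" using assms by blast
  have "\<forall>\<^sub>F n in sequentially. growth (n + L) / growth n < 2"
    by (rule order_tendstoD(2)[OF growth_ratio]) simp
  then obtain n0 where n0: "\<And>n. n \<ge> n0 \<Longrightarrow> growth (n + L) / growth n < 2"
    by (auto simp: eventually_sequentially)
  have "norm (f n / growth n - 0) < e" if "n \<ge> n0" for n
  proof -
    have "M * (f n / growth n) \<le> growth (n + L) / growth n"
      using L[of n] by (simp add: divide_right_mono flip: of_nat_mult)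
    also have "\<dots> < 2" by (rule n0[OF that])
    also have "\<dots> < M * e" using M \<open>e > 0\<close> by (simp add: pos_divide_less_eq)
    finally have "f n / growth n < e"
      using \<open>M > 0\<close> by (subst (asm) mult_less_cancel_left_pos) simp_all
    then show ?thesis by simp
  qed
  then show "\<exists>n0. \<forall>n\<ge>n0. norm (f n / growth n - 0) < e" by blast
qed

text \<open>The translates of \<open>H \<inter> ball n\<close> by different representatives are
  disjoint and stay in \<open>ball (n + L)\<close>. Allowing only part of the transversal covers
  infinite index too.\<close>

lemma card_subgroup_ball_mult_le:
  assumes H: "subgroup H G" and R: "R \<subseteq> rreps H" "R \<subseteq> ball L"
  shows "card R * card (H \<inter> ball n) \<le> growth (n + L)"
proof -
  let ?f = "\<lambda>(h, r). h \<otimes> r"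
  have inj: "inj_on ?f ((H \<inter> ball n) \<times> R)"
  proof (rule inj_onI, clarify)
    fix h r h' r' assume *: "h \<in> H" "h' \<in> H" "r \<in> R" "r' \<in> R" "h \<otimes> r = h' \<otimes> r'"
    have c: "h \<in> carrier G" "h' \<in> carrier G" "r \<in> carrier G" "r' \<in> carrier G"
      using * R(2) ball_closed subgroup.mem_carrier[OF H] by blast+
    have rep: "rrep H (h \<otimes> r) = r" if "h \<in> H" "r \<in> R" for h r
    proof -
      have "r \<in> carrier G" "h \<in> carrier G" using that R(2) ball_closed subgroup.mem_carrier[OF H] by blast+
      then have "rrep H (h \<otimes> r) = rrep H r"
        using rrep_eq_iff[OF H] that(1) by (simp add: m_assoc)
      then show ?thesis using rreps_rrep[OF H] R(1) that(2) by auto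
    qed
    have "r = r'" using rep *(1-4) *(5) by metis
    then show "h = h' \<and> r = r'" using *(5) c by simp
  qed
  have "card R * card (H \<inter> ball n) = card (?f ` ((H \<inter> ball n) \<times> R))"
    by (simp add: card_image[OF inj] card_cartesian_product)
  also have "\<dots> \<le> growth (n + L)"
    using R(2) by (intro card_mono finite_ball) (auto intro: ball_mult)
  finally show ?thesis .
qed

text \<open>Removing its representative turns an element of \<open>ball n\<close> into one of
  \<open>H\<close> at the cost of at most \<open>L\<close> steps; the pair of both determines the
  element.\<close>

lemma growth_le_card_subgroup_ball_mult:
  assumes H: "subgroup H G" and R: "finite (rreps H)" "rreps H \<subseteq> ball L"
  shows "growth n \<le> card (rreps H) * card (H \<inter> ball (n + L))"
proof -
  let ?f = "\<lambda>g. (g \<otimes> inv (rrep H g), rrep H g)"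
  have "inj_on ?f (ball n)"
  proof (rule inj_onI)
    fix g h assume *: "g \<in> ball n" "h \<in> ball n" "?f g = ?f h"
    then have c: "g \<in> carrier G" "h \<in> carrier G" using ball_closed by blast+
    have cancel: "x \<otimes> inv (rrep H x) \<otimes> rrep H x = x" if "x \<in> carrier G" for x
      using that rrep_closed[OF H that] by (simp add: m_assoc)
    have "g \<otimes> inv (rrep H g) = h \<otimes> inv (rrep H h)" "rrep H g = rrep H h"
      using *(3) by blast+
    then show "g = h" using cancel[OF c(1)] cancel[OF c(2)] by metis
  qed
  moreover have "?f ` ball n \<subseteq> (H \<inter> ball (n + L)) \<times> rreps H"
  proof (rule image_subsetI)
    fix g assume g: "g \<in> ball n"
    then have c: "g \<in> carrier G" using ball_closed by blast
    then have r: "rrep H g \<in> rreps H" by (simp add: rreps_def)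
    then have "g \<otimes> inv (rrep H g) \<in> ball (n + L)"
      using R(2) by (intro ball_mult[OF g] ball_inv) auto
    then show "(g \<otimes> inv (rrep H g), rrep H g) \<in> (H \<inter> ball (n + L)) \<times> rreps H"
      using r mult_inv_rrep[OF H c] by simp
  qed
  ultimately have "growth n \<le> card ((H \<inter> ball (n + L)) \<times> rreps H)"
    by (rule card_inj_on_le) (simp add: R(1) finite_ball)
  then show ?thesis by (simp add: card_cartesian_product mult.commute)
qed

text \<open>For a subgroup of infinite index, \<open>card (rreps H)\<close> and hence the limit is \<open>0\<close>.\<close>

lemma subgroup_density:
  assumes H: "subgroup H G"
  shows "(\<lambda>n. card (H \<inter> ball n) / growth n) \<longlonglongrightarrow> 1 / card (rreps H)"
proof (cases "finite (rreps H)")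
  case True
  obtain L where L: "rreps H \<subseteq> ball L"
    using finite_subset_ball[OF True rreps_closed[OF H]] by blast
  define m where "m = card (rreps H)"
  have "rreps H \<noteq> {}" by (auto simp: rreps_def)
  then have "m > 0" using True by (simp add: m_def card_gt_0_iff)
  have upper: "card (H \<inter> ball n) / growth n \<le> growth (n + L) / growth n / m" for n
  proof -
    have "real m * card (H \<inter> ball n) \<le> growth (n + L)"
      using card_subgroup_ball_mult_le[OF H order_refl L, of n] unfolding m_def of_nat_mult[symmetric] of_nat_le_iff .
    then have "card (H \<inter> ball n) \<le> growth (n + L) / real m"
      using \<open>m > 0\<close> by (simp add: pos_le_divide_eq mult.commute)
    from divide_right_mono[OF this, of "growth n"] show ?thesis by (simp add: mult.commute)
  qed
  have lower: "growth n / growth (n + L) / m \<le> card (H \<inter> ball (n + L)) / growth (n + L)" for n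
  proof -
    have "growth n \<le> real m * card (H \<inter> ball (n + L))"
      using growth_le_card_subgroup_ball_mult[OF H True L, of n] unfolding m_def of_nat_mult[symmetric] of_nat_le_iff .
    then have "growth n / real m \<le> card (H \<inter> ball (n + L))"
      using \<open>m > 0\<close> by (simp add: pos_divide_le_eq mult.commute)
    from divide_right_mono[OF this, of "growth (n + L)"] show ?thesis by (simp add: mult.commute)
  qed
  \<comment> \<open>The lower bound is only available at radius \<open>n + L\<close>, so the
    sandwich is carried out there and the shift removed afterwards.\<close>
  have "(\<lambda>n. card (H \<inter> ball (n + L)) / growth (n + L)) \<longlonglongrightarrow> 1 / m"
  proof (rule tendsto_sandwich)
    show "\<forall>\<^sub>F n in sequentially. growth n / growth (n + L) / m \<le> card (H \<inter> ball (n + L)) / growth (n + L)"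
      using lower by simp
    show "\<forall>\<^sub>F n in sequentially. card (H \<inter> ball (n + L)) / growth (n + L)
        \<le> growth (n + L + L) / growth (n + L) / m"
      using upper by simp
    have "(\<lambda>n. inverse (growth (n + L) / growth n)) \<longlonglongrightarrow> inverse 1"
      by (rule tendsto_inverse[OF growth_ratio]) simp
    then have "(\<lambda>n. growth n / growth (n + L)) \<longlonglongrightarrow> 1" by simp
    from tendsto_divide[OF this tendsto_const] show "(\<lambda>n. growth n / growth (n + L) / m) \<longlonglongrightarrow> 1 / m"
      using \<open>m > 0\<close> by simp
    have "(\<lambda>n. growth (n + L + L) / growth (n + L)) \<longlonglongrightarrow> 1"
      by (rule LIMSEQ_ignore_initial_segment[OF growth_ratio])
    from tendsto_divide[OF this tendsto_const]
    show "(\<lambda>n. growth (n + L + L) / growth (n + L) / m) \<longlonglongrightarrow> 1 / m"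
      using \<open>m > 0\<close> by simp
  qed
  then show ?thesis unfolding m_def by (rule LIMSEQ_offset)
next
  case False
  \<comment> \<open>With infinite index, any number \<open>M\<close> of representatives can be
    chosen, and \<open>L\<close> is taken large enough for them.\<close>
  have "\<exists>L. \<forall>n. M * card (H \<inter> ball n) \<le> growth (n + L)" for M
  proof -
    obtain R where R: "finite R" "card R = M" "R \<subseteq> rreps H"
      using infinite_arbitrarily_large[OF False] by blast
    then obtain L where "R \<subseteq> ball L" using finite_subset_ball rreps_closed[OF H] by blast
    then show ?thesis using card_subgroup_ball_mult_le[OF H R(3)] R(2) by blast
  qed
  then show ?thesis using False by (simp add: growth_ratio_tendsto_zero)
qed

section \<open>The mean of the inverse class size over balls\<close>

lemma sum_inverse_class_size:
  "(\<Sum>x\<in>fc_center \<inter> ball n. 1 / card (cls x))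
    = (\<Sum>r\<in>rreps tame_centralizer. real (card ({x \<in> fc_center. x \<otimes> r = r \<otimes> x} \<inter> ball n)))
        / card (rreps tame_centralizer)"
proof -
  let ?R = "rreps tame_centralizer" and ?F = "fc_center \<inter> ball n"
  have fin: "finite ?F" "finite ?R" using finite_ball finite_rreps_tame_centralizer by auto
  have "(\<Sum>x\<in>?F. 1 / card (cls x)) = (\<Sum>x\<in>?F. card {r \<in> ?R. x \<otimes> r = r \<otimes> x} / card ?R)"
    by (intro sum.cong refl inverse_card_cls) simp
  also have "\<dots> = (\<Sum>x\<in>?F. real (card {r \<in> ?R. x \<otimes> r = r \<otimes> x})) / card ?R"
    by (simp add: sum_divide_distrib)
  \<comment> \<open>Commuting pairs \<open>(x, r)\<close> are counted twice, first by
    \<open>x\<close> and then by \<open>r\<close>.\<close>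
  also have "(\<Sum>x\<in>?F. real (card {r \<in> ?R. x \<otimes> r = r \<otimes> x}))
      = (\<Sum>x\<in>?F. \<Sum>r\<in>?R. if x \<otimes> r = r \<otimes> x then 1 else 0)"
    by (simp add: sum.If_cases fin Int_def)
  also have "\<dots> = (\<Sum>r\<in>?R. \<Sum>x\<in>?F. if x \<otimes> r = r \<otimes> x then 1 else 0)"
    by (rule sum.swap)
  also have "\<dots> = (\<Sum>r\<in>?R. real (card ({x \<in> fc_center. x \<otimes> r = r \<otimes> x} \<inter> ball n)))"
  proof (rule sum.cong[OF refl])
    fix r
    have "{x \<in> fc_center. x \<otimes> r = r \<otimes> x} \<inter> ball n = ?F \<inter> {x. x \<otimes> r = r \<otimes> x}" by auto
    then show "(\<Sum>x\<in>?F. if x \<otimes> r = r \<otimes> x then 1 else 0)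
        = real (card ({x \<in> fc_center. x \<otimes> r = r \<otimes> x} \<inter> ball n))"
      by (simp add: sum.If_cases fin)
  qed
  finally show ?thesis .
qed

lemma mean_inverse_class_size_tendsto:
  "(\<lambda>n. (\<Sum>x\<in>fc_center \<inter> ball n. 1 / card (cls x)) / growth n) \<longlonglongrightarrow> mean_inverse_class_size"
proof -
  let ?R = "rreps tame_centralizer" and ?H = "\<lambda>r. {x \<in> fc_center. x \<otimes> r = r \<otimes> x}"
  have "(\<lambda>n. (\<Sum>r\<in>?R. card (?H r \<inter> ball n) / growth n) / card ?R)
      \<longlonglongrightarrow> (\<Sum>r\<in>?R. 1 / card (rreps (?H r))) / card ?R"
  \<comment> \<open>\<open>tendsto_divide\<close> asks for a nonzero denominator; for denominator 0
    both sides are 0 by convention.\<close>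
  proof (cases "card ?R = 0")
    case False
    then show ?thesis
      using rreps_closed[OF tame_centralizer_subgroup]
      by (intro tendsto_divide tendsto_sum tendsto_const subgroup_density fc_centralizer_subgroup) auto
  qed simp
  moreover have "(\<Sum>r\<in>?R. card (?H r \<inter> ball n) / growth n) / card ?R
      = (\<Sum>x\<in>fc_center \<inter> ball n. 1 / card (cls x)) / growth n" for n
    unfolding sum_inverse_class_size sum_divide_distrib[symmetric] divide_divide_eq_left
    by (simp add: mult.commute)
  ultimately show ?thesis by (simp add: mean_inverse_class_size_def)
qed

subsection \<open>Counting classes\<close>

definition fin_classes :: "nat \<Rightarrow> 'a set set" where
  "fin_classes n = {C \<in> ball_conjugacy_classes G S n. finite C}"

definition inf_classes :: "nat \<Rightarrow> 'a set set" where
  "inf_classes n = {C \<in> ball_conjugacy_classes G S n. infinite C}"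

lemma ball_conjugacy_classes_eq: "ball_conjugacy_classes G S n = cls ` ball n"
proof
  show "ball_conjugacy_classes G S n \<subseteq> cls ` ball n"
    using cls_eq unfolding ball_conjugacy_classes_def conjugacy_classes_eq by blast
  show "cls ` ball n \<subseteq> ball_conjugacy_classes G S n"
    using mem_cls_self ball_closed unfolding ball_conjugacy_classes_def conjugacy_classes_eq by blast
qed

lemma fin_classes_eq: "fin_classes n = cls ` (fc_center \<inter> ball n)"
  using ball_closed unfolding fin_classes_def ball_conjugacy_classes_eq fc_center_def by blast

lemma card_ball_conjugacy_classes:
  "card (ball_conjugacy_classes G S n) = card (fin_classes n) + card (inf_classes n)"
proof -
  have "finite (ball_conjugacy_classes G S n)"
    by (simp add: ball_conjugacy_classes_eq finite_ball)
  moreover have "ball_conjugacy_classes G S n = fin_classes n \<union> inf_classes n"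
    "fin_classes n \<inter> inf_classes n = {}"
    by (auto simp: fin_classes_def inf_classes_def)
  ultimately show ?thesis by (simp add: card_Un_disjoint)
qed

text \<open>Grouped by class, the sum gives each class the proportion of its members lying in the
  ball. This is at most 1, and it becomes 1 after a bounded enlargement of the radius.\<close>

lemma sum_inverse_class_size_fibres:
  "(\<Sum>x\<in>fc_center \<inter> ball n. 1 / card (cls x))
    = (\<Sum>C\<in>fin_classes n. card {x \<in> fc_center \<inter> ball n. cls x = C} / card C)"
proof -
  have fin: "finite (fc_center \<inter> ball n)" using finite_ball by simp
  have "(\<Sum>x\<in>fc_center \<inter> ball n. 1 / real (card (cls x)))
      = (\<Sum>C\<in>fin_classes n. \<Sum>x\<in>{x \<in> fc_center \<inter> ball n. cls x = C}. 1 / real (card (cls x)))"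
    unfolding fin_classes_eq by (rule sum.image_gen[OF fin])
  also have "\<dots> = (\<Sum>C\<in>fin_classes n. card {x \<in> fc_center \<inter> ball n. cls x = C} / card C)"
    by (intro sum.cong refl) simp
  finally show ?thesis .
qed

lemma fin_class_cases:
  assumes "C \<in> fin_classes n"
  shows "finite C" "card C > 0" "{x \<in> fc_center \<inter> ball m. cls x = C} \<subseteq> C"
proof -
  obtain x where x: "x \<in> fc_center" "C = cls x" using assms by (auto simp: fin_classes_eq)
  then show "finite C" by (simp add: fc_center_def)
  moreover have "x \<in> C" using x fc_center_closed mem_cls_self by blast
  ultimately show "card C > 0" by (auto simp: card_gt_0_iff)
  show "{x \<in> fc_center \<inter> ball m. cls x = C} \<subseteq> C"
    using fc_center_closed mem_cls_self by blast
qed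

lemma sum_inverse_class_size_le:
  "(\<Sum>x\<in>fc_center \<inter> ball n. 1 / card (cls x)) \<le> card (fin_classes n)"
proof -
  have "card {x \<in> fc_center \<inter> ball n. cls x = C} / card C \<le> 1" if C: "C \<in> fin_classes n" for C
    using fin_class_cases[OF C] card_mono[OF fin_class_cases(1)[OF C] fin_class_cases(3)[OF C]]
    by simp
  then have "(\<Sum>C\<in>fin_classes n. card {x \<in> fc_center \<inter> ball n. cls x = C} / card C)
      \<le> (\<Sum>C\<in>fin_classes n. 1)"
    by (rule sum_mono)
  then show ?thesis by (simp add: sum_inverse_class_size_fibres)
qed

text \<open>Representatives of \<open>tame_centralizer\<close> of length at most \<open>L\<close>
  produce all conjugates, so a finite class that meets \<open>ball n\<close> lies entirely in the
  ball of radius \<open>n + (L + L)\<close>.\<close>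

lemma card_fin_classes_le:
  "\<exists>L. \<forall>n. card (fin_classes n) \<le> (\<Sum>x\<in>fc_center \<inter> ball (n + L). 1 / card (cls x))"
proof -
  obtain L where L: "rreps tame_centralizer \<subseteq> ball L"
    using finite_subset_ball[OF finite_rreps_tame_centralizer rreps_closed[OF tame_centralizer_subgroup]]
    by blast
  have "card (fin_classes n) \<le> (\<Sum>x\<in>fc_center \<inter> ball (n + (L + L)). 1 / card (cls x))" for n
  proof -
    let ?m = "n + (L + L)"
    have eq: "card {x \<in> fc_center \<inter> ball ?m. cls x = C} / card C = 1" if C: "C \<in> fin_classes n" for C
    proof -
      obtain x where x: "x \<in> fc_center" "x \<in> ball n" "C = cls x" using C by (auto simp: fin_classes_eq)
      have xc: "x \<in> carrier G" using x(1) by (rule fc_center_closed)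
      have "y \<in> fc_center \<inter> ball ?m \<and> cls y = C" if y: "y \<in> C" for y
      proof -
        have cy: "cls y = C" using cls_eq[OF xc] y x(3) by blast
        have "y \<in> (\<lambda>r. inv r \<otimes> x \<otimes> r) ` rreps tame_centralizer"
          using cls_eq_conj_rreps[OF tame_centralizer_subgroup xc fc_center_commute[OF x(1)]] y x(3) by simp
        then obtain r where "r \<in> ball L" "y = inv r \<otimes> x \<otimes> r" using L by auto
        then have "y \<in> ball (L + n + L)" using x(2) by (auto intro!: ball_mult ball_inv)
        moreover have "y \<in> fc_center"
          using cy fin_class_cases(1)[OF C] y x(3) cls_closed[OF xc] by (auto simp: fc_center_def)
        ultimately show ?thesis using cy by (simp add: add_ac)
      qed
      then have "{x \<in> fc_center \<inter> ball ?m. cls x = C} = C" using fin_class_cases(3)[OF C] by blast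
      then show ?thesis using fin_class_cases(2)[OF C] by simp
    qed
    have "real (card (fin_classes n)) = (\<Sum>C\<in>fin_classes n. 1)" by simp
    also have "\<dots> = (\<Sum>C\<in>fin_classes n. card {x \<in> fc_center \<inter> ball ?m. cls x = C} / card C)"
      by (rule sum.cong[OF refl eq[symmetric]])
    \<comment> \<open>The classes that meet only the larger ball contribute nonnegative
      terms.\<close>
    also have "\<dots> \<le> (\<Sum>C\<in>fin_classes ?m. card {x \<in> fc_center \<inter> ball ?m. cls x = C} / card C)"
      using ball_mono[of n ?m] by (intro sum_mono2) (auto simp: fin_classes_eq finite_ball)
    finally show ?thesis by (simp add: sum_inverse_class_size_fibres)
  qed
  then show ?thesis by blast
qed

lemma fin_classes_tendsto: "(\<lambda>n. card (fin_classes n) / growth n) \<longlonglongrightarrow> mean_inverse_class_size"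
proof -
  obtain L where L: "\<And>n. card (fin_classes n) \<le> (\<Sum>x\<in>fc_center \<inter> ball (n + L). 1 / card (cls x))"
    using card_fin_classes_le by blast
  show ?thesis
  proof (rule tendsto_sandwich)
    show "\<forall>\<^sub>F n in sequentially. (\<Sum>x\<in>fc_center \<inter> ball n. 1 / card (cls x)) / growth n
        \<le> card (fin_classes n) / growth n"
      by (intro always_eventually allI divide_right_mono sum_inverse_class_size_le) simp
    show "\<forall>\<^sub>F n in sequentially. card (fin_classes n) / growth n
        \<le> (\<Sum>x\<in>fc_center \<inter> ball (n + L). 1 / card (cls x)) / growth n"
      by (intro always_eventually allI divide_right_mono L) simp
    show "(\<lambda>n. (\<Sum>x\<in>fc_center \<inter> ball n. 1 / card (cls x)) / growth n) \<longlonglongrightarrow> mean_inverse_class_size"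
      by (rule mean_inverse_class_size_tendsto)
    then show "(\<lambda>n. (\<Sum>x\<in>fc_center \<inter> ball (n + L). 1 / card (cls x)) / growth n)
        \<longlonglongrightarrow> mean_inverse_class_size"
      by (rule growth_ratio_shift)
  qed
qed

text \<open>Uniform conjugators give every infinite class that meets \<open>ball n\<close> at least
  \<open>M\<close> members in a ball larger by a constant. Distinct classes are disjoint, so
  \<open>M\<close> times their number is at most the size of that ball.\<close>

lemma inf_classes_tendsto: "(\<lambda>n. card (inf_classes n) / growth n) \<longlonglongrightarrow> 0"
proof (rule growth_ratio_tendsto_zero)
  fix M
  obtain E where E: "finite E" "E \<subseteq> A"
    and conj: "\<And>x. \<lbrakk>x \<in> carrier G; x \<notin> fc_center\<rbrakk>
      \<Longrightarrow> \<exists>Y \<subseteq> (\<lambda>a. inv a \<otimes> x \<otimes> a) ` E. finite Y \<and> card Y = M"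
    using uniform_conjugators by blast
  obtain L where L: "E \<subseteq> ball L" using finite_subset_ball[OF E(1)] E(2) A_closed by blast
  have "M * card (inf_classes n) \<le> growth (n + (L + L))" for n
  proof -
    have "\<exists>Y \<subseteq> C \<inter> ball (n + (L + L)). finite Y \<and> card Y = M" if C: "C \<in> inf_classes n" for C
    proof -
      obtain x where x: "x \<in> ball n" "C = cls x" "infinite C"
        using C by (auto simp: inf_classes_def ball_conjugacy_classes_eq)
      have "x \<in> carrier G" "x \<notin> fc_center" using x ball_closed by (auto simp: fc_center_def)
      then obtain Y where Y: "Y \<subseteq> (\<lambda>a. inv a \<otimes> x \<otimes> a) ` E" "finite Y" "card Y = M"
        using conj by blast
      have "inv a \<otimes> x \<otimes> a \<in> C \<inter> ball (n + (L + L))" if a: "a \<in> E" for a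
      proof -
        have "inv a \<otimes> x \<otimes> a \<in> ball (L + n + L)"
          using L a x(1) by (intro ball_mult ball_inv) auto
        moreover have "a \<in> carrier G" using a E(2) A_closed by blast
        ultimately show ?thesis unfolding x(2) cls_def by (auto simp: add_ac)
      qed
      then have "Y \<subseteq> C \<inter> ball (n + (L + L))" using Y(1) by blast
      with Y(2,3) show ?thesis by blast
    qed
    then obtain Y where Y: "\<And>C. C \<in> inf_classes n \<Longrightarrow>
        Y C \<subseteq> C \<inter> ball (n + (L + L)) \<and> finite (Y C) \<and> card (Y C) = M"
      by metis
    have disj: "C \<inter> D = {}" if CD: "C \<in> inf_classes n" "D \<in> inf_classes n" "C \<noteq> D" for C D
    proof -
      obtain x y where "x \<in> carrier G" "C = cls x" "y \<in> carrier G" "D = cls y"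
        using CD(1,2) ball_closed unfolding inf_classes_def ball_conjugacy_classes_eq by blast
      then show ?thesis using cls_eq CD(3) by blast
    qed
    have "finite (inf_classes n)" by (simp add: inf_classes_def ball_conjugacy_classes_eq finite_ball)
    then have "card (\<Union>C\<in>inf_classes n. Y C) = (\<Sum>C\<in>inf_classes n. card (Y C))"
      using Y disj by (intro card_UN_disjoint) blast+
    also have "\<dots> = M * card (inf_classes n)" using Y by simp
    finally have "M * card (inf_classes n) = card (\<Union>C\<in>inf_classes n. Y C)" by simp
    also have "\<dots> \<le> growth (n + (L + L))" using Y by (intro card_mono finite_ball) blast
    finally show ?thesis .
  qed
  then show "\<exists>L. \<forall>n. M * card (inf_classes n) \<le> growth (n + L)" by blast
qed

text \<open>The quotients converge, so the limsup is their limit, and its value does not mention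
  \<open>S\<close>.\<close>

lemma conjugacy_ratio_eq: "conjugacy_ratio G S = ereal mean_inverse_class_size"
proof -
  have "(\<lambda>n. card (fin_classes n) / growth n + card (inf_classes n) / growth n)
      \<longlonglongrightarrow> mean_inverse_class_size + 0"
    by (intro tendsto_add fin_classes_tendsto inf_classes_tendsto)
  then have "(\<lambda>n. card (ball_conjugacy_classes G S n) / growth n) \<longlonglongrightarrow> mean_inverse_class_size"
    by (simp add: card_ball_conjugacy_classes add_divide_distrib)
  then show ?thesis
    unfolding conjugacy_ratio_def by (intro lim_imp_Limsup) simp_all
qed

end

theorem theorem3p9:
  fixes G :: "('a, 'b) monoid_scheme" and S T :: "'a set"
  assumes "group G"
    and "finitely_generated G"
    and "virtually_abelian G"
    and "finite_generating_set G S"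
    and "finite_generating_set G T"
  shows "conjugacy_ratio G S = conjugacy_ratio G T"
proof -
  obtain A where A: "subgroup A G" "comm_group (G\<lparr>carrier := A\<rparr>)" "finite (rcosets\<^bsub>G\<^esub> A)"
    using assms(3) by (auto simp: virtually_abelian_def)
  interpret A: comm_group "G\<lparr>carrier := A\<rparr>" by (rule A(2))
  have "virtually_abelian_group G A"
    using assms(1) A A.m_comm by (simp add: virtually_abelian_group_def virtually_abelian_group_axioms_def)
  \<comment> \<open>The same \<open>A\<close> is used for both generating sets, so both ratios equal
    the same \<open>mean_inverse_class_size\<close>.\<close>
  then have "fin_gen_virtually_abelian_group G X A" if "finite_generating_set G X" for X
    using assms(1) that
    by (simp add: fin_gen_virtually_abelian_group_def fin_gen_group_def fin_gen_group_axioms_def)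
  from this[OF assms(4)] this[OF assms(5)] show ?thesis
    by (simp add: fin_gen_virtually_abelian_group.conjugacy_ratio_eq)
qed

end
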